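(* Let $\mathcal{H}$ be a real Hilbert space and let $A,B$ be nonempty closed convex subsets of $\mathcal{H}$. Assume that the best approximation sets $E=\{a\in A:\ \mathrm{dist}(a,B)=\mathrm{dist}(A,B)\}$ and $F=\{b\in B:\ \mathrm{dist}(b,A)=\mathrm{dist}(A,B)\}$ are nonempty and bounded. Then the following are equivalent: (i) the pair $(A,B)$ is regular; (ii) the pair $(A,B)$ is $d$-stable.
   Context: Notation. For $x\in\mathcal{H}$ and nonempty $C\subset\mathcal{H}$, $\mathrm{dist}(x,C)=\inf_{c\in C}\|x-c\|$, and $\mathrm{dist}(A,B)=\inf_{a\in A}\inf_{b\in B}\|a-b\|$. $P_C$ denotes the metric (nearest point) projection onto a nonempty closed convex set $C\subset\mathcal{H}$. $\mathbb{B}_{\mathcal{H}}$ is the closed unit ball of $\mathcal{H}$. Displacement vector. $v:=P_{\overline{B-A}}(0)$, where $B-A=\{b-a:\ b\in B,\ a\in A\}$ and the bar denotes norm closure. Regular pair. Let $A,B$ be nonempty closed convex sets with $E$ and $F$ nonempty. The pair $(A,B)$ is regular if for every $\varepsilon>0$ there exists $\delta>0$ such that for every $x\in\mathcal{H}$: $\max\{\mathrm{dist}(x,A),\mathrm{dist}(x,B-v)\}\le\delta$ implies $\mathrm{dist}(x,E)\le\varepsilon$. Attouch-Wets convergence. For closed sets $C,D\subset\mathcal{H}$ let $e(C,D)=\sup_{c\in C}\mathrm{dist}(c,D)$ (with $e(\emptyset,D)=0$). For nonempty closed $C,D$ and $r>0$ put $e_r(C,D)=e(C\cap r\mathbb{B}_{\mathcal{H}},D)$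 and $\mathrm{D}_{\mathrm{H},r}(C,D)=\max\{e_r(C,D),e_r(D,C)\}$. A sequence $\{C_n\}_{n\ge1}$ of nonempty closed sets converges to a nonempty closed set $C$ in the Attouch-Wets sense if $\lim_{n\to\infty}\mathrm{D}_{\mathrm{H},r}(C_n,C)=0$ for every $r>0$. $d$-stability. The pair $(A,B)$ is $d$-stable if for all sequences $\{A_n\}_{n\ge1}$ and $\{B_n\}_{n\ge1}$ of nonempty closed convex subsets of $\mathcal{H}$ converging in the Attouch-Wets sense to $A$ and $B$ respectively, and for every $a_0\in\mathcal{H}$, the perturbed alternating projection sequences defined by $b_n=P_{B_n}(a_{n-1})$, $a_n=P_{A_n}(b_n)$ ($n\ge1$) satisfy $\lim_{n\to\infty}\mathrm{dist}(a_n,E)=0$ and $\lim_{n\to\infty}\mathrm{dist}(b_n,F)=0$. *)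

theory Defs
  imports "HOL-Analysis.Analysis"
begin

text \<open>
  A real Hilbert space is a type of sort \<open>{real_inner, banach}\<close>. The distances
  \<open>dist(x, C)\<close> and \<open>dist(A, B)\<close> are \<^const>\<open>infdist\<close> and \<^const>\<open>setdist\<close>; on empty sets
  these return 0, but they are only used below for nonempty sets.
\<close>

text \<open>
  The library's \<^const>\<open>closest_point\<close> requires \<^class>\<open>heine_borel\<close>, which would exclude
  infinite-dimensional spaces.
\<close>

definition metric_proj :: "'a::real_inner set \<Rightarrow> 'a \<Rightarrow> 'a" where
  "metric_proj C x = (THE p. p \<in> C \<and> (\<forall>y\<in>C. dist x p \<le> dist x y))"

definition best_approx_left :: "'a::real_inner set \<Rightarrow> 'a set \<Rightarrow> 'a set" where
  "best_approx_left A B = {a \<in> A. infdist a B = setdist A B}"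

definition best_approx_right :: "'a::real_inner set \<Rightarrow> 'a set \<Rightarrow> 'a set" where
  "best_approx_right A B = {b \<in> B. infdist b A = setdist A B}"

definition displacement :: "'a::real_inner set \<Rightarrow> 'a set \<Rightarrow> 'a" where
  "displacement A B = metric_proj (closure {b - a |b a. b \<in> B \<and> a \<in> A}) 0"

definition regular_pair :: "'a::real_inner set \<Rightarrow> 'a set \<Rightarrow> bool" where
  "regular_pair A B \<longleftrightarrow>
     (\<forall>\<epsilon>>0. \<exists>\<delta>>0. \<forall>x.
        max (infdist x A) (infdist x ((\<lambda>b. b - displacement A B) ` B)) \<le> \<delta>
          \<longrightarrow> infdist x (best_approx_left A B) \<le> \<epsilon>)"

text \<open>
  The excess may be infinite, hence the values in \<^typ>\<open>ennreal\<close>. There the supremum of the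
  empty set is 0, so the convention \<open>e(\<emptyset>, D) = 0\<close> holds automatically.
\<close>

definition excess :: "'a::real_inner set \<Rightarrow> 'a set \<Rightarrow> ennreal" where
  "excess C D = (SUP c\<in>C. ennreal (infdist c D))"

definition excess_ball :: "real \<Rightarrow> 'a::real_inner set \<Rightarrow> 'a set \<Rightarrow> ennreal" where
  "excess_ball r C D = excess (C \<inter> cball 0 r) D"

definition hausdorff_ball :: "real \<Rightarrow> 'a::real_inner set \<Rightarrow> 'a set \<Rightarrow> ennreal" where
  "hausdorff_ball r C D = max (excess_ball r C D) (excess_ball r D C)"

definition attouch_wets :: "(nat \<Rightarrow> 'a::real_inner set) \<Rightarrow> 'a set \<Rightarrow> bool" where
  "attouch_wets Cs C \<longleftrightarrow> (\<forall>r>0. (\<lambda>n. hausdorff_ball r (Cs n) C) \<longlonglongrightarrow> 0)"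

text \<open>
  The sequences of sets and the sequence \<open>b\<close> start at index 1, their values at 0 being
  irrelevant; the sequence \<open>a\<close> starts at index 0 with the initial point.
\<close>

definition perturbed_alternating_projections ::
  "(nat \<Rightarrow> 'a::real_inner set) \<Rightarrow> (nat \<Rightarrow> 'a set) \<Rightarrow> 'a \<Rightarrow> (nat \<Rightarrow> 'a) \<Rightarrow> (nat \<Rightarrow> 'a) \<Rightarrow> bool" where
  "perturbed_alternating_projections As Bs a0 a b \<longleftrightarrow>
     a 0 = a0 \<and>
     (\<forall>n\<ge>1. b n = metric_proj (Bs n) (a (n - 1)) \<and> a n = metric_proj (As n) (b n))"

definition d_stable :: "'a::real_inner set \<Rightarrow> 'a set \<Rightarrow> bool" where
  "d_stable A B \<longleftrightarrow>
     (\<forall>As Bs.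
        (\<forall>n\<ge>1. As n \<noteq> {} \<and> closed (As n) \<and> convex (As n)) \<and>
        (\<forall>n\<ge>1. Bs n \<noteq> {} \<and> closed (Bs n) \<and> convex (Bs n)) \<and>
        attouch_wets As A \<and> attouch_wets Bs B \<longrightarrow>
        (\<forall>a0 a b. perturbed_alternating_projections As Bs a0 a b \<longrightarrow>
           (\<lambda>n. infdist (a n) (best_approx_left A B)) \<longlonglongrightarrow> 0 \<and>
           (\<lambda>n. infdist (b n) (best_approx_right A B)) \<longlonglongrightarrow> 0))"

end

theory Submission
  imports Defs
begin

text \<open>
  Write \<open>v\<close> for the displacement vector. Then \<open>E = A \<inter> (B - v)\<close> and \<open>F = E + v\<close>, so regularity
  says that a point that is nearly in \<open>A\<close> and in \<open>B - v\<close> is near their intersection.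

  Regularity implies stability. Projecting \<open>x\<close> to \<open>B\<close> and then to \<open>A\<close> decreases the squared distance
  to \<open>E\<close> by at least the square of the gap \<open>x - P\<^sub>B x + v\<close>, and for \<open>x\<close> in \<open>A\<close> outside a neighbourhood
  of \<open>E\<close> regularity bounds this gap from below. Perturbing the sets costs an error that tends to zero,
  because Attouch-Wets convergence makes the projections converge uniformly on bounded sets
  (\<open>attouch_wets_metric_proj\<close>). The iterates are not known to be bounded in advance; but as \<open>E\<close> is
  bounded, the lower bound on the gap is only needed at distance \<open>\<epsilon>\<close> from \<open>E\<close>, and by convexity it
  grows linearly from there on (\<open>perturbed_step\<close>). Hence the distance to \<open>E\<close> eventually drops by a
  fixed amount in every step, until it is small, and then it stays small.

  Stability implies regularity. If regularity fails, some points stay away from \<open>E\<close> but lie in a fixed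
  ball and arbitrarily near \<open>A\<close> and \<open>B - v\<close>. Large bounded parts of \<open>A\<close> and \<open>B - v\<close> can be strictly
  separated by a tiny shift (\<open>small_shift_separates\<close>): for \<open>v \<noteq> 0\<close> this is a shift along \<open>v\<close>, and for
  \<open>v = 0\<close> it exists because otherwise the differences \<open>B - A\<close> would be dense around the origin, an
  interiority condition that forces regularity on bounded sets (\<open>common_point_near_small_gap\<close>). Join to
  the separated parts one point \<open>x\<close> on a separating hyperplane near such a witness, and translate the
  second part back by \<open>v\<close>. This gives small perturbations of \<open>A\<close> and \<open>B\<close> whose alternating projections
  converge to \<open>x\<close> from every starting point (\<open>trap_exists\<close>). Running through better and better such
  perturbations, each of them until the iterate is near its \<open>x\<close>, gives sequences of sets that
  converge to \<open>A\<close> and \<open>B\<close> and an orbit that is infinitely often far from \<open>E\<close>.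
\<close>

section \<open>Metric projections in a Hilbert space\<close>

text \<open>
  By the parallelogram law, points of a convex set that nearly attain the distance to \<open>x\<close> are close to
  each other, so a minimizing sequence is Cauchy.
\<close>

lemma nearest_point_exists:
  fixes C :: "'a::{real_inner, banach} set"
  assumes "C \<noteq> {}" "closed C" "convex C"
  shows "\<exists>p\<in>C. \<forall>y\<in>C. dist x p \<le> dist x y"
proof -
  define d where "d = infdist x C"
  have d_le: "d \<le> dist x y" if "y \<in> C" for y
    using that by (simp add: d_def infdist_le)
  have d0: "0 \<le> d" by (simp add: d_def infdist_nonneg)
  have ex: "\<exists>y\<in>C. dist x y < d + e" if "0 < e" for e
  proof (rule ccontr)
    assume "\<not> ?thesis"
    then have "d + e \<le> (INF y\<in>C. dist x y)"
      using assms(1) by (intro cINF_greatest) (auto simp: not_less)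
    with that assms(1) show False by (simp add: d_def infdist_notempty)
  qed
  have close: "(dist y z)\<^sup>2 \<le> 4 * e * (2 * d + e)"
    if "y \<in> C" "z \<in> C" "dist x y < d + e" "dist x z < d + e" for y z e
  proof -
    have "(1/2) *\<^sub>R y + (1/2) *\<^sub>R z \<in> C"
      using assms(3) that by (intro convexD) auto
    then have "d \<le> dist x ((1/2) *\<^sub>R y + (1/2) *\<^sub>R z)" by (rule d_le)
    then have "d\<^sup>2 \<le> (norm (x - ((1/2) *\<^sub>R y + (1/2) *\<^sub>R z)))\<^sup>2"
      using d0 by (intro power_mono) (auto simp: dist_norm)
    moreover have "(norm (y - z))\<^sup>2 = 2 * (norm (x - y))\<^sup>2 + 2 * (norm (x - z))\<^sup>2
        - 4 * (norm (x - ((1/2) *\<^sub>R y + (1/2) *\<^sub>R z)))\<^sup>2"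
      by (simp add: power2_norm_eq_inner inner_diff inner_add inner_commute algebra_simps)
    moreover have "(norm (x - y))\<^sup>2 \<le> (d + e)\<^sup>2" "(norm (x - z))\<^sup>2 \<le> (d + e)\<^sup>2"
      using that by (auto intro!: power_mono simp: dist_norm)
    moreover have "4 * (d + e)\<^sup>2 - 4 * d\<^sup>2 = 4 * e * (2 * d + e)"
      by (simp add: power2_eq_square algebra_simps)
    ultimately show ?thesis by (simp add: dist_norm)
  qed
  have "\<forall>n. \<exists>y\<in>C. dist x y < d + 1 / real (Suc n)"
    by (intro allI ex) simp
  then obtain y where y: "\<And>n. y n \<in> C" "\<And>n. dist x (y n) < d + 1 / real (Suc n)"
    by metis
  have "Cauchy y"
  proof (rule metric_CauchyI)
    fix e :: real assume "0 < e"
    have "(\<lambda>n. 4 * (1 / real (Suc n)) * (2 * d + 1 / real (Suc n))) \<longlonglongrightarrow> 4 * 0 * (2 * d + 0)"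
      by (intro tendsto_intros LIMSEQ_Suc[OF lim_1_over_n])
    then have "\<forall>\<^sub>F n in sequentially. 4 * (1 / real (Suc n)) * (2 * d + 1 / real (Suc n)) < e\<^sup>2"
      using \<open>0 < e\<close> by (intro order_tendstoD) auto
    then obtain N where N: "4 * (1 / real (Suc N)) * (2 * d + 1 / real (Suc N)) < e\<^sup>2"
      by (auto simp: eventually_sequentially)
    have "dist (y m) (y n) < e" if "m \<ge> N" "n \<ge> N" for m n
    proof -
      have le: "dist x (y k) < d + 1 / real (Suc N)" if "k \<ge> N" for k
      proof -
        have "1 / real (Suc k) \<le> 1 / real (Suc N)"
          using that by (simp add: field_simps)
        with y(2)[of k] show ?thesis by linarith
      qed
      have "(dist (y m) (y n))\<^sup>2 < e\<^sup>2"
        using close[OF y(1) y(1) le[OF that(1)] le[OF that(2)]] N by linarith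
      then show ?thesis using \<open>0 < e\<close> by (simp add: power2_less_imp_less)
    qed
    then show "\<exists>M. \<forall>m\<ge>M. \<forall>n\<ge>M. dist (y m) (y n) < e" by blast
  qed
  then obtain p where p: "y \<longlonglongrightarrow> p" using Cauchy_convergent convergent_def by blast
  have "p \<in> C" using closed_sequentially[OF assms(2) _ p] y(1) by blast
  moreover have "dist x p \<le> d"
  proof (rule LIMSEQ_le)
    show "(\<lambda>n. dist x (y n)) \<longlonglongrightarrow> dist x p" by (intro tendsto_intros p)
    show "(\<lambda>n. d + 1 / real (Suc n)) \<longlonglongrightarrow> d"
      using tendsto_add[OF tendsto_const LIMSEQ_Suc[OF lim_1_over_n], of d] by simp
    show "\<exists>N. \<forall>n\<ge>N. dist x (y n) \<le> d + 1 / real (Suc n)"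
      using y(2) by (auto intro: less_imp_le)
  qed
  ultimately show ?thesis using d_le by (meson order_trans)
qed

lemma
  fixes C :: "'a::{real_inner, banach} set"
  assumes "C \<noteq> {}" "closed C" "convex C"
  shows metric_proj_in: "metric_proj C x \<in> C"
    and metric_proj_le: "y \<in> C \<Longrightarrow> dist x (metric_proj C x) \<le> dist x y"
    and metric_proj_inner_le: "y \<in> C \<Longrightarrow> inner (x - metric_proj C x) (y - metric_proj C x) \<le> 0"
    and dist_metric_proj: "dist x (metric_proj C x) = infdist x C"
proof -
  obtain p where p: "p \<in> C" "\<forall>y\<in>C. dist x p \<le> dist x y"
    using nearest_point_exists[OF assms] by blast
  have *: "metric_proj C x \<in> C \<and> (\<forall>y\<in>C. dist x (metric_proj C x) \<le> dist x y)"
    unfolding metric_proj_def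
  proof (rule theI[where a = p])
    show "q = p" if "q \<in> C \<and> (\<forall>y\<in>C. dist x q \<le> dist x y)" for q
      using any_closest_point_unique[OF assms(3,2)] that p by blast
  qed (use p in blast)
  then show "metric_proj C x \<in> C" by blast
  show le: "y \<in> C \<Longrightarrow> dist x (metric_proj C x) \<le> dist x y" for y using * by blast
  show "y \<in> C \<Longrightarrow> inner (x - metric_proj C x) (y - metric_proj C x) \<le> 0"
    using any_closest_point_dot[OF assms(3,2)] * by blast
  show "dist x (metric_proj C x) = infdist x C"
    unfolding infdist_notempty[OF assms(1)]
    by (rule antisym[OF cINF_greatest[OF assms(1)] cINF_lower[OF bdd_below.I[of _ 0]]])
       (use * in auto)
qed

lemma metric_proj_eqI:
  fixes C :: "'a::{real_inner, banach} set"
  assumes "closed C" "convex C" "p \<in> C" and obt: "\<And>y. y \<in> C \<Longrightarrow> inner (x - p) (y - p) \<le> 0"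
  shows "metric_proj C x = p"
proof -
  have "C \<noteq> {}" using assms(3) by blast
  note P = this assms(1,2)
  let ?q = "metric_proj C x"
  have "inner (x - p) (?q - p) \<le> 0" "inner (x - ?q) (p - ?q) \<le> 0"
    using obt metric_proj_in[OF P] metric_proj_inner_le[OF P assms(3)] by auto
  then have "inner (?q - p) (?q - p) \<le> 0"
    by (simp add: inner_diff inner_commute algebra_simps)
  then show ?thesis by (metis inner_gt_zero_iff not_less right_minus_eq)
qed

lemma metric_proj_self:
  fixes C :: "'a::{real_inner, banach} set"
  assumes "closed C" "convex C" "p \<in> C"
  shows "metric_proj C p = p"
  using assms by (intro metric_proj_eqI) auto

text \<open>
  Projections are firmly nonexpansive: adding the two obtuse-angle inequalities bounds the inner
  product of the displacements of the projections and of the residuals from below.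
\<close>

lemma metric_proj_firmly_nonexpansive:
  fixes C :: "'a::{real_inner, banach} set"
  assumes "C \<noteq> {}" "closed C" "convex C"
  shows "(norm (metric_proj C x - metric_proj C y))\<^sup>2
           + (norm ((x - metric_proj C x) - (y - metric_proj C y)))\<^sup>2 \<le> (norm (x - y))\<^sup>2"
proof -
  let ?p = "metric_proj C x" and ?q = "metric_proj C y"
  have "inner (x - ?p) (?q - ?p) \<le> 0" "inner (y - ?q) (?p - ?q) \<le> 0"
    using metric_proj_in[OF assms] metric_proj_inner_le[OF assms] by blast+
  then show ?thesis
    by (simp add: power2_norm_eq_inner inner_diff inner_commute algebra_simps)
qed

lemma metric_proj_nonexpansive:
  fixes C :: "'a::{real_inner, banach} set"
  assumes "C \<noteq> {}" "closed C" "convex C"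
  shows "dist (metric_proj C x) (metric_proj C y) \<le> dist x y"
proof -
  have "(norm (metric_proj C x - metric_proj C y))\<^sup>2 \<le> (norm (x - y))\<^sup>2"
    using metric_proj_firmly_nonexpansive[OF assms, of x y]
      zero_le_power2[of "norm ((x - metric_proj C x) - (y - metric_proj C y))"] by linarith
  then show ?thesis unfolding dist_norm by (rule power2_le_imp_le) simp
qed

lemma convex_infdist_le:
  fixes C :: "'a::{real_inner, banach} set"
  assumes "C \<noteq> {}" "closed C" "convex C"
  shows "convex {z. infdist z C \<le> e}"
proof (rule convexI)
  fix x y and u v :: real
  assume xy: "x \<in> {z. infdist z C \<le> e}" "y \<in> {z. infdist z C \<le> e}"
    and uv: "0 \<le> u" "0 \<le> v" "u + v = 1"
  let ?p = "metric_proj C x" and ?q = "metric_proj C y"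
  have "u *\<^sub>R ?p + v *\<^sub>R ?q \<in> C"
    using assms(3) metric_proj_in[OF assms] uv by (intro convexD) auto
  moreover have "dist (u *\<^sub>R x + v *\<^sub>R y) (u *\<^sub>R ?p + v *\<^sub>R ?q) \<le> e"
  proof -
    have "norm (u *\<^sub>R (x - ?p) + v *\<^sub>R (y - ?q)) \<le> u * norm (x - ?p) + v * norm (y - ?q)"
      by (rule norm_triangle_le) (use uv in simp)
    also have "\<dots> \<le> u * e + v * e"
      using xy dist_metric_proj[OF assms] uv by (intro add_mono mult_left_mono) (auto simp: dist_norm)
    also have "\<dots> = e" using uv by (simp flip: distrib_right)
    finally show ?thesis by (simp add: dist_norm algebra_simps)
  qed
  ultimately show "u *\<^sub>R x + v *\<^sub>R y \<in> {z. infdist z C \<le> e}"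
    by (auto intro: infdist_le2)
qed

lemma closed_infdist_le: "closed {z. infdist z C \<le> e}"
  by (intro closed_Collect_le continuous_intros)

lemma closure_convex_hull_minimal:
  fixes S T :: "'a::real_normed_vector set"
  assumes "S \<subseteq> T" "closed T" "convex T"
  shows "closure (convex hull S) \<subseteq> T"
  using assms by (intro closure_minimal hull_minimal) auto

section \<open>Attouch-Wets convergence\<close>

lemma excess_ball_le_iff:
  "excess_ball r C D \<le> ennreal e \<longleftrightarrow> (\<forall>c\<in>C. norm c \<le> r \<longrightarrow> infdist c D \<le> e)" if "0 \<le> e"
  using that by (auto simp: excess_ball_def excess_def SUP_le_iff infdist_nonneg)

lemma attouch_wets_iff:
  "attouch_wets Cs C \<longleftrightarrow>
     (\<forall>r>0. \<forall>e>0. \<forall>\<^sub>F n in sequentially.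
        (\<forall>c\<in>Cs n. norm c \<le> r \<longrightarrow> infdist c C \<le> e) \<and> (\<forall>c\<in>C. norm c \<le> r \<longrightarrow> infdist c (Cs n) \<le> e))"
  (is "_ \<longleftrightarrow> (\<forall>r>0. \<forall>e>0. \<forall>\<^sub>F n in sequentially. ?P r e n)")
proof -
  have P: "?P r e n \<longleftrightarrow> hausdorff_ball r (Cs n) C \<le> ennreal e" if "0 < e" for r e n
    using that by (simp add: hausdorff_ball_def excess_ball_le_iff)
  have "(\<lambda>n. hausdorff_ball r (Cs n) C) \<longlonglongrightarrow> 0 \<longleftrightarrow> (\<forall>e>0. \<forall>\<^sub>F n in sequentially. ?P r e n)"
    for r
  proof
    assume L: "(\<lambda>n. hausdorff_ball r (Cs n) C) \<longlonglongrightarrow> 0"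
    show "\<forall>e>0. \<forall>\<^sub>F n in sequentially. ?P r e n"
    proof (intro allI impI)
      fix e :: real assume e: "0 < e"
      from order_tendstoD(2)[OF L, of "ennreal e"] e
      show "\<forall>\<^sub>F n in sequentially. ?P r e n"
        by (auto simp: P elim: eventually_mono)
    qed
  next
    assume R: "\<forall>e>0. \<forall>\<^sub>F n in sequentially. ?P r e n"
    show "(\<lambda>n. hausdorff_ball r (Cs n) C) \<longlonglongrightarrow> 0"
    proof (rule order_tendstoI)
      fix a :: ennreal assume "0 < a"
      then obtain b where b: "0 < b" "b < a" using dense by blast
      then obtain e where e: "b = ennreal e" "0 < e"
        by (cases b) (auto simp: ennreal_zero_less_top)
      with R have "\<forall>\<^sub>F n in sequentially. ?P r e n" by blast
      then show "\<forall>\<^sub>F n in sequentially. hausdorff_ball r (Cs n) C < a"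
        by (rule eventually_mono) (use P e b in auto)
    qed simp
  qed
  then show ?thesis by (simp add: attouch_wets_def)
qed

text \<open>
  Attouch-Wets convergence of convex sets makes their projections converge, uniformly on bounded
  sets: by the obtuse-angle inequality, a point of the limit set that is almost nearest to \<open>x\<close> is
  close to the nearest one, and the projection of \<open>P\<^sub>n x\<close> to the limit set is such a point.
\<close>

lemma attouch_wets_metric_proj:
  fixes C :: "'a::{real_inner, banach} set"
  assumes C: "C \<noteq> {}" "closed C" "convex C"
    and Cs: "\<And>n. n \<ge> 1 \<Longrightarrow> Cs n \<noteq> {} \<and> closed (Cs n) \<and> convex (Cs n)"
    and AW: "attouch_wets Cs C" and "0 < r" "0 < e"
  shows "\<forall>\<^sub>F n in sequentially. \<forall>x. norm x \<le> r \<longrightarrow> dist (metric_proj (Cs n) x) (metric_proj C x) \<le> e"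
proof -
  obtain c where c: "c \<in> C" using C by blast
  define M where "M = 2 * r + norm c + 1"
  \<comment> \<open>\<open>M\<close> bounds both projections of \<open>x\<close>. The tolerance \<open>h\<close> is chosen such that the two errors of the
    proof, \<open>h\<close> and \<open>sqrt (4 * h * (M + 1))\<close>, are at most \<open>e / 2\<close>.\<close>
  define h where "h = min 1 (min (e / 2) (e\<^sup>2 / (16 * (M + 1))))"
  have M: "0 < M" "r \<le> M" using \<open>0 < r\<close> norm_ge_zero[of c] unfolding M_def by linarith+
  have h: "0 < h" "h \<le> 1" "h \<le> e / 2" "h \<le> e\<^sup>2 / (16 * (M + 1))"
    unfolding h_def using M \<open>0 < e\<close>
    by (simp, simp, linarith, linarith)
  have h2: "4 * h * (M + 1) \<le> (e / 2)\<^sup>2"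
    using h(4) M by (simp add: field_simps power2_eq_square)
  have "\<forall>\<^sub>F n in sequentially. (\<forall>c\<in>Cs n. norm c \<le> M \<longrightarrow> infdist c C \<le> h)
      \<and> (\<forall>c\<in>C. norm c \<le> M \<longrightarrow> infdist c (Cs n) \<le> h)"
    using AW M h by (simp add: attouch_wets_iff)
  then show ?thesis
    using eventually_ge_at_top[of 1]
  proof eventually_elim
    case (elim n)
    then have D: "Cs n \<noteq> {}" "closed (Cs n)" "convex (Cs n)" using Cs by blast+
    have CD: "infdist y C \<le> h" if "y \<in> Cs n" "norm y \<le> M" for y using elim that by blast
    have DC: "infdist y (Cs n) \<le> h" if "y \<in> C" "norm y \<le> M" for y using elim that by blast
    show ?case
    proof (intro allI impI)
      fix x :: 'a assume x: "norm x \<le> r"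
      define p where "p = metric_proj C x"
      define q where "q = metric_proj (Cs n) x"
      define p' where "p' = metric_proj (Cs n) p"
      define q' where "q' = metric_proj C q"
      have mem: "p \<in> C" "q \<in> Cs n" "p' \<in> Cs n" "q' \<in> C"
        unfolding p_def q_def p'_def q'_def using C D by (auto intro: metric_proj_in)
      have xc: "dist x c \<le> r + norm c"
        using norm_triangle_ineq4[of x c] x by (simp add: dist_norm)
      have xp: "dist x p \<le> r + norm c"
        using metric_proj_le[OF C c, of x] xc by (simp add: p_def)
      have pM: "norm p \<le> M"
        using xp x norm_triangle_ineq2[of p x] by (simp add: M_def dist_norm norm_minus_commute)
      have "dist x q \<le> r + norm c + 1"
      proof -
        have "dist c (metric_proj (Cs n) c) \<le> 1"
          using DC[OF c] h(2) M_def \<open>0 < r\<close> dist_metric_proj[OF D, of c] by simp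
        moreover have "dist x q \<le> dist x (metric_proj (Cs n) c)"
          unfolding q_def by (rule metric_proj_le[OF D metric_proj_in[OF D]])
        ultimately show ?thesis using xc dist_triangle[of x "metric_proj (Cs n) c" c] by linarith
      qed
      then have qM: "norm q \<le> M"
        using x norm_triangle_ineq2[of q x] by (simp add: M_def dist_norm norm_minus_commute)
      have pp': "dist p p' \<le> h"
        using DC[OF mem(1) pM] dist_metric_proj[OF D, of p] by (simp add: p'_def)
      have qq': "dist q q' \<le> h"
        using CD[OF mem(2) qM] dist_metric_proj[OF C, of q] by (simp add: q'_def)
      have "dist x q \<le> dist x p'" unfolding q_def by (rule metric_proj_le[OF D mem(3)])
      then have xq': "dist x q' \<le> dist x p + 2 * h"
        using pp' qq' dist_triangle[of x p' p] dist_triangle[of x q' q] by linarith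
      have "inner (x - p) (q' - p) \<le> 0"
        unfolding p_def by (rule metric_proj_inner_le[OF C mem(4)])
      then have "(dist p q')\<^sup>2 \<le> (dist x q')\<^sup>2 - (dist x p)\<^sup>2"
        by (simp add: dist_norm power2_norm_eq_inner inner_diff inner_commute algebra_simps)
      also have "\<dots> \<le> (dist x p + 2 * h)\<^sup>2 - (dist x p)\<^sup>2"
        using xq' by (intro diff_right_mono power_mono) auto
      also have "\<dots> = 4 * h * (dist x p + h)"
        by (simp add: power2_eq_square algebra_simps)
      also have "\<dots> \<le> 4 * h * (M + 1)"
        using h xp \<open>0 < r\<close> by (intro mult_left_mono add_mono) (auto simp: M_def)
      also note h2
      finally have "dist p q' \<le> e / 2" by (rule power2_le_imp_le) (use \<open>0 < e\<close> in simp)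
      then show "dist (metric_proj (Cs n) x) (metric_proj C x) \<le> e"
        using qq' h(3) dist_triangle[of q p q'] by (simp add: p_def q_def dist_commute)
    qed
  qed
qed

section \<open>The displacement vector\<close>

lemma convex_minkowski_differences:
  fixes S T :: "'a::real_vector set"
  assumes "convex S" "convex T"
  shows "convex {b - a |b a. b \<in> T \<and> a \<in> S}"
proof -
  have "{b - a |b a. b \<in> T \<and> a \<in> S} = (\<Union>b\<in>T. \<Union>a\<in>S. {b - a})" by blast
  then show ?thesis using convex_differences[OF assms(2,1)] by simp
qed

text \<open>
  The first claim is the obtuse-angle inequality at the projection of the origin to
  \<open>closure (B - A)\<close>. If the displacement vector \<open>v\<close> is nonzero, the claim separates \<open>A\<close> and \<open>B\<close> by a
  slab of width \<open>norm v\<close> orthogonal to \<open>v\<close>.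
\<close>

lemma
  fixes A B :: "'a::{real_inner, banach} set"
  assumes A: "A \<noteq> {}" "closed A" "convex A" and B: "B \<noteq> {}" "closed B" "convex B"
  shows displacement_inner_ge:
      "a \<in> A \<Longrightarrow> b \<in> B \<Longrightarrow> (norm (displacement A B))\<^sup>2 \<le> inner (displacement A B) (b - a)"
    and norm_displacement: "norm (displacement A B) = setdist A B"
proof -
  define S where "S = {b - a |b a. b \<in> B \<and> a \<in> A}"
  define v where "v = displacement A B"
  have v: "v = metric_proj (closure S) 0" by (simp add: v_def displacement_def S_def)
  have S: "closure S \<noteq> {}" "closed (closure S)" "convex (closure S)"
    using A B convex_minkowski_differences[OF A(3) B(3)] by (auto simp: S_def intro!: convex_closure)
  have vS: "v \<in> closure S" unfolding v by (rule metric_proj_in[OF S])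
  have mem: "b - a \<in> closure S" if "a \<in> A" "b \<in> B" for a b
    using that closure_subset[of S] by (auto simp: S_def)
  show "(norm (displacement A B))\<^sup>2 \<le> inner (displacement A B) (b - a)" if "a \<in> A" "b \<in> B"
    using metric_proj_inner_le[OF S mem[OF that], of 0]
    by (simp add: v_def[symmetric] v[symmetric] power2_norm_eq_inner inner_diff)
  have "norm v \<le> setdist A B"
  proof (rule le_setdistI)
    fix a b assume "a \<in> A" "b \<in> B"
    then show "norm v \<le> dist a b"
      using metric_proj_le[OF S mem, of a b 0] by (simp add: v dist_norm norm_minus_commute)
  qed (use A B in auto)
  moreover have "setdist A B \<le> norm v"
  proof (rule field_le_epsilon)
    fix e :: real assume "0 < e"
    then obtain s where s: "s \<in> S" "dist s v < e" using vS closure_approachable by blast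
    then obtain a b where ab: "a \<in> A" "b \<in> B" "s = b - a" by (auto simp: S_def)
    have "setdist A B \<le> norm s"
      using setdist_le_dist[OF ab(1,2)] by (simp add: ab dist_norm norm_minus_commute)
    also have "\<dots> \<le> norm v + e"
      using s(2) norm_triangle_ineq2[of s v] by (simp add: dist_norm)
    finally show "setdist A B \<le> norm v + e" .
  qed
  ultimately show "norm (displacement A B) = setdist A B" by (simp add: v_def)
qed

text \<open>
  A point of \<open>closure (B - A)\<close> of minimal norm is unique, so a pair realising the distance of the
  two sets differs exactly by the displacement vector.
\<close>

lemma displacement_eqI:
  fixes A B :: "'a::{real_inner, banach} set"
  assumes A: "A \<noteq> {}" "closed A" "convex A" and B: "B \<noteq> {}" "closed B" "convex B"
    and ab: "a \<in> A" "b \<in> B" "dist a b = setdist A B"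
  shows "b = a + displacement A B"
proof -
  let ?v = "displacement A B"
  have "(norm (b - a - ?v))\<^sup>2 = (norm (b - a))\<^sup>2 - 2 * inner ?v (b - a) + (norm ?v)\<^sup>2"
    by (simp add: power2_norm_eq_inner inner_diff inner_commute algebra_simps)
  also have "\<dots> \<le> 0"
    using displacement_inner_ge[OF A B ab(1,2)] ab(3) norm_displacement[OF A B]
    by (simp add: dist_norm norm_minus_commute)
  finally show ?thesis by (simp add: algebra_simps)
qed

lemma best_approx_left_eq:
  fixes A B :: "'a::{real_inner, banach} set"
  assumes A: "A \<noteq> {}" "closed A" "convex A" and B: "B \<noteq> {}" "closed B" "convex B"
  shows "best_approx_left A B = {a \<in> A. a + displacement A B \<in> B}"
proof (intro set_eqI iffI)
  fix a assume "a \<in> best_approx_left A B"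
  then have a: "a \<in> A" "infdist a B = setdist A B" by (auto simp: best_approx_left_def)
  have "metric_proj B a = a + displacement A B"
    using a metric_proj_in[OF B] dist_metric_proj[OF B] by (intro displacement_eqI[OF A B]) auto
  then show "a \<in> {a \<in> A. a + displacement A B \<in> B}" using a metric_proj_in[OF B, of a] by simp
next
  fix a assume "a \<in> {a \<in> A. a + displacement A B \<in> B}"
  then have a: "a \<in> A" "a + displacement A B \<in> B" by auto
  have "infdist a B \<le> setdist A B"
    using infdist_le[OF a(2), of a] norm_displacement[OF A B] by (simp add: dist_norm)
  moreover have "setdist A B \<le> infdist a B"
    using setdist_le_sing[OF a(1), of B] by (simp add: infdist_eq_setdist)
  ultimately show "a \<in> best_approx_left A B" using a by (simp add: best_approx_left_def)
qed

lemma best_approx_right_eq: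
  fixes A B :: "'a::{real_inner, banach} set"
  assumes A: "A \<noteq> {}" "closed A" "convex A" and B: "B \<noteq> {}" "closed B" "convex B"
  shows "best_approx_right A B = (\<lambda>a. a + displacement A B) ` best_approx_left A B"
proof (intro set_eqI iffI)
  let ?v = "displacement A B"
  fix b assume "b \<in> best_approx_right A B"
  then have b: "b \<in> B" "infdist b A = setdist A B" by (auto simp: best_approx_right_def)
  let ?a = "metric_proj A b"
  have "b = ?a + ?v"
    using b metric_proj_in[OF A] dist_metric_proj[OF A]
    by (intro displacement_eqI[OF A B]) (auto simp: dist_commute)
  then show "b \<in> (\<lambda>a. a + ?v) ` best_approx_left A B"
    using b metric_proj_in[OF A, of b] by (intro image_eqI[of _ _ ?a]) (auto simp: best_approx_left_eq[OF A B])
next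
  let ?v = "displacement A B"
  fix b assume "b \<in> (\<lambda>a. a + ?v) ` best_approx_left A B"
  then obtain a where a: "a \<in> A" "b \<in> B" "b = a + ?v" by (auto simp: best_approx_left_eq[OF A B])
  have "infdist b A \<le> setdist A B"
    using infdist_le[OF a(1), of b] norm_displacement[OF A B] a(3) by (simp add: dist_norm)
  moreover have "setdist A B \<le> infdist b A"
    using setdist_le_sing[OF a(2), of A] by (simp add: infdist_eq_setdist setdist_sym)
  ultimately show "b \<in> best_approx_right A B" using a by (simp add: best_approx_right_def)
qed

lemma infdist_image_diff: "infdist x ((\<lambda>b. b - v) ` B) = infdist (x + v) B"
  for v :: "'a::real_normed_vector"
proof (cases "B = {}")
  case False
  then show ?thesis by (simp add: infdist_notempty image_image dist_norm algebra_simps)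
qed (simp add: infdist_def)

text \<open>
  The two implications use the displacement vector only through the separation property
  \<open>inner_ge\<close> and the description of the solution set as \<open>A \<inter> (B - v)\<close>.
\<close>

locale convex_pair =
  fixes A B E :: "'a::{real_inner, banach} set" and v :: 'a
  assumes A: "A \<noteq> {}" "closed A" "convex A"
    and B: "B \<noteq> {}" "closed B" "convex B"
    and inner_ge: "\<And>a b. a \<in> A \<Longrightarrow> b \<in> B \<Longrightarrow> (norm v)\<^sup>2 \<le> inner v (b - a)"
    and E_eq: "E = {a \<in> A. a + v \<in> B}"
    and E_ne: "E \<noteq> {}"
    and E_bdd: "bounded E"
begin

lemma E_closed: "closed E" and E_convex: "convex E"
proof -
  have *: "E = A \<inter> (\<lambda>x. -v + x) ` B"
    by (force simp: E_eq image_iff algebra_simps)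
  show "closed E" unfolding * using A B by (intro closed_Int closed_translation) auto
  show "convex E" unfolding * using A B by (intro convex_Int convex_translation) auto
qed

lemmas E = E_ne E_closed E_convex

lemma metric_proj_B: "metric_proj B e = e + v" if "e \<in> E"
proof (rule metric_proj_eqI[OF B(2,3)])
  show "e + v \<in> B" using that by (simp add: E_eq)
  show "inner (e - (e + v)) (y - (e + v)) \<le> 0" if "y \<in> B" for y
    using inner_ge[OF _ that, of e] \<open>e \<in> E\<close>
    by (simp add: E_eq inner_diff inner_add power2_norm_eq_inner)
qed

lemma metric_proj_A: "metric_proj A (e + v) = e" if "e \<in> E"
proof (rule metric_proj_eqI[OF A(2,3)])
  show "e \<in> A" using that by (simp add: E_eq)
  show "inner (e + v - e) (y - e) \<le> 0" if "y \<in> A" for y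
    using inner_ge[OF that, of "e + v"] \<open>e \<in> E\<close>
    by (simp add: E_eq inner_diff inner_add power2_norm_eq_inner)
qed

end

section \<open>Regularity implies stability\<close>

text \<open>
  The errors of the perturbed iteration tend to zero but need not be summable. What makes up for this
  is a decrease by a fixed amount as long as the target level \<open>e\<close> is exceeded.
\<close>

lemma tendsto_zero_if_eventually_decreasing:
  fixes d :: "nat \<Rightarrow> real"
  assumes nn: "\<And>n. 0 \<le> d n"
    and dec: "\<And>e. 0 < e \<Longrightarrow> \<exists>g>0. \<forall>\<^sub>F n in sequentially. d (Suc n) \<le> max e (d n - g)"
  shows "d \<longlonglongrightarrow> 0"
proof (rule LIMSEQ_I)
  fix r :: real assume "0 < r"
  define e where "e = r / 2"
  have e: "0 < e" "e < r" using \<open>0 < r\<close> by (auto simp: e_def)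
  obtain g N where g: "0 < g" and N: "\<And>n. n \<ge> N \<Longrightarrow> d (Suc n) \<le> max e (d n - g)"
    using dec[OF e(1)] by (auto simp: eventually_sequentially)
  have "\<exists>n\<ge>N. d n \<le> e"
  proof (rule ccontr)
    assume no: "\<not> ?thesis"
    have "d (N + k) \<le> d N - real k * g" for k
    proof (induction k)
      case (Suc k)
      have "d (Suc (N + k)) \<le> max e (d (N + k) - g)" by (rule N) simp
      moreover have "\<not> d (Suc (N + k)) \<le> e" using no by (metis le_add1 add_Suc_right)
      ultimately show ?case using Suc by (simp add: algebra_simps)
    qed simp
    moreover obtain k where "d N < real k * g" using reals_Archimedean3[OF g] by blast
    ultimately show False using nn[of "N + k"] by (metis diff_less_0_iff_less not_less order_trans)
  qed
  then obtain M where M: "M \<ge> N" "d M \<le> e" by blast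
  have "d n \<le> e" if "n \<ge> M" for n
    using that
  proof (induction n rule: dec_induct)
    case (step n)
    then show ?case using N[of n] M(1) g by (simp add: max_def split: if_splits)
  qed (rule M(2))
  then show "\<exists>no. \<forall>n\<ge>no. norm (d n - 0) < r"
    using e(2) nn by (intro exI[of _ M]) (auto simp: abs_of_nonneg intro: le_less_trans)
qed

context convex_pair
begin

text \<open>
  One perturbed step. Let \<open>e\<close> be the projection of \<open>x\<close> to \<open>E\<close> and \<open>d\<close> their distance. If \<open>d\<close> is at
  least \<open>\<epsilon>\<close>, the segment from \<open>e\<close> to \<open>x\<close> contains a point \<open>y\<close> at distance \<open>\<epsilon>\<close> from \<open>E\<close>. It lies
  in a fixed ball, where the perturbed sets are close to \<open>A\<close> and \<open>B\<close>, so \<open>y\<close> is near \<open>A\<close> and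
  regularity keeps \<open>y + v\<close> away from the perturbed \<open>B\<close>. By convexity of the perturbed \<open>B\<close> the gap
  grows linearly along the segment: the residuals of \<open>x\<close> and \<open>e\<close> differ by at least \<open>\<delta>d/(2\<epsilon>)\<close>.
  Firm nonexpansiveness turns this into a decrease of the distance by a fixed factor, which beats
  the perturbation errors \<open>\<eta>\<close>. Looking at \<open>y\<close> instead of \<open>x\<close> is what makes the estimate uniform in
  \<open>x\<close>, although the perturbed sets are controlled on bounded sets only.
\<close>

lemma perturbed_step:
  assumes reg: "\<And>y. max (infdist y A) (infdist (y + v) B) \<le> \<delta> \<Longrightarrow> infdist y E < \<epsilon>"
    and pos: "0 < \<delta>" "0 < \<epsilon>" "0 < \<eta>" and r: "\<And>e. e \<in> E \<Longrightarrow> norm e + \<epsilon> + norm v + \<eta> \<le> r"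
    and small: "\<eta> \<le> \<delta> / 4" "2 * \<eta> \<le> \<epsilon>" "8 * \<eta> \<le> \<delta>\<^sup>2 / (4 * \<epsilon>\<^sup>2) * \<epsilon>"
    and A': "A' \<noteq> {}" "closed A'" "convex A'" and A'': "A'' \<noteq> {}" "closed A''" "convex A''"
    and B'': "B'' \<noteq> {}" "closed B''" "convex B''"
    and nA': "\<And>z. norm z \<le> r \<Longrightarrow> dist (metric_proj A' z) (metric_proj A z) \<le> \<eta>"
    and nA'': "\<And>z. norm z \<le> r \<Longrightarrow> dist (metric_proj A'' z) (metric_proj A z) \<le> \<eta>"
    and nB'': "\<And>z. norm z \<le> r \<Longrightarrow> dist (metric_proj B'' z) (metric_proj B z) \<le> \<eta>"
    and x: "x \<in> A'"
  defines "b \<equiv> metric_proj B'' x"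
  defines "a \<equiv> metric_proj A'' b"
  shows "infdist a E \<le> max (2 * \<epsilon>) (infdist x E - \<delta>\<^sup>2 / (4 * \<epsilon>\<^sup>2) * \<epsilon> / 4)"
    and "infdist b ((\<lambda>e. e + v) ` E) \<le> infdist x E + \<eta>"
proof -
  define e where "e = metric_proj E x"
  define d where "d = dist x e"
  have e: "e \<in> E" unfolding e_def by (rule metric_proj_in[OF E])
  have d: "infdist x E = d" unfolding d_def e_def by (rule dist_metric_proj[OF E, symmetric])
  have d0: "0 \<le> d" by (simp add: d_def)
  define f where "f = metric_proj B'' e"
  define u where "u = (x - b) - (e - f)"
  have re: "norm e + \<epsilon> + norm v + \<eta> \<le> r" by (rule r[OF e])
  have nr: "norm e \<le> r" using re pos norm_ge_zero[of v] by linarith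
  have nrv: "norm (e + v) \<le> r" using re pos norm_triangle_ineq[of e v] by linarith
  have f: "dist f (e + v) \<le> \<eta>"
    using nB''[OF nr] by (simp add: f_def metric_proj_B[OF e])
  have "dist (metric_proj A'' f) (metric_proj A'' (e + v)) \<le> \<eta>"
    using metric_proj_nonexpansive[OF A'', of f "e + v"] f by linarith
  moreover have "dist (metric_proj A'' (e + v)) e \<le> \<eta>"
    using nA''[OF nrv] by (simp add: metric_proj_A[OF e])
  ultimately have Af: "dist (metric_proj A'' f) e \<le> 2 * \<eta>"
    using dist_triangle[of "metric_proj A'' f" e "metric_proj A'' (e + v)"] by linarith
  have bf: "(dist b f)\<^sup>2 + (norm u)\<^sup>2 \<le> d\<^sup>2"
    using metric_proj_firmly_nonexpansive[OF B'', of x e]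
    by (simp add: b_def f_def u_def d_def dist_norm)
  then have bfd: "dist b f \<le> d"
    using d0 zero_le_power2[of "norm u"] by (intro power2_le_imp_le[of "dist b f" d]) linarith+
  have ae: "infdist a E \<le> dist b f + 2 * \<eta>"
  proof -
    have "infdist a E \<le> dist a e" by (rule infdist_le[OF e])
    also have "\<dots> \<le> dist a (metric_proj A'' f) + 2 * \<eta>"
      using dist_triangle[of a e "metric_proj A'' f"] Af by linarith
    also have "dist a (metric_proj A'' f) \<le> dist b f"
      unfolding a_def by (rule metric_proj_nonexpansive[OF A''])
    finally show ?thesis by simp
  qed
  show "infdist b ((\<lambda>e. e + v) ` E) \<le> infdist x E + \<eta>"
  proof -
    have "infdist b ((\<lambda>e. e + v) ` E) \<le> dist b (e + v)" using e by (intro infdist_le) auto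
    then show ?thesis using dist_triangle[of b "e + v" f] f bfd d by linarith
  qed
  show "infdist a E \<le> max (2 * \<epsilon>) (infdist x E - \<delta>\<^sup>2 / (4 * \<epsilon>\<^sup>2) * \<epsilon> / 4)"
  proof (cases "d < \<epsilon>")
    case True
    then show ?thesis using ae bfd small(2) by linarith
  next
    case False
    then have de: "\<epsilon> \<le> d" "0 < d" using pos by auto
    \<comment> \<open>The factor that shrinks the segment from \<open>e\<close> to \<open>x\<close> to length \<open>\<epsilon>\<close>.\<close>
    define t where "t = \<epsilon> / d"
    have t: "0 < t" "t \<le> 1" "t * d = \<epsilon>" using de pos by (auto simp: t_def)
    define y where "y = e + t *\<^sub>R (x - e)"
    have ye: "dist y e = \<epsilon>" using t by (simp add: y_def dist_norm d_def norm_minus_commute)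
    have yE: "\<epsilon> \<le> infdist y E"
    proof -
      have "x - y = (1 - t) *\<^sub>R (x - e)" by (simp add: y_def algebra_simps)
      then have "dist x y = (1 - t) * d" using t by (simp add: dist_norm d_def)
      then show ?thesis
        using infdist_triangle[of x E y] d t(3) by (simp add: algebra_simps)
    qed
    have yr: "norm y \<le> norm e + \<epsilon>" using norm_triangle_sub[of y e] ye by (simp add: dist_norm)
    have yA: "infdist y A \<le> \<delta>"
    proof -
      \<comment> \<open>A point of the perturbed set next to \<open>y\<close>: shrink \<open>x\<close> towards the projection of \<open>e\<close> instead of \<open>e\<close>.\<close>
      define y' where "y' = (1 - t) *\<^sub>R metric_proj A' e + t *\<^sub>R x"
      have y': "y' \<in> A'"
        unfolding y'_def using t x metric_proj_in[OF A'] by (intro convexD[OF A'(3)]) auto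
      have Ae: "dist (metric_proj A' e) e \<le> \<eta>"
        using nA'[OF nr] metric_proj_self[OF A(2,3), of e] e by (simp add: E_eq)
      have "y' - y = (1 - t) *\<^sub>R (metric_proj A' e - e)"
        by (simp add: y_def y'_def algebra_simps)
      then have "dist y' y = (1 - t) * dist (metric_proj A' e) e" using t by (simp add: dist_norm)
      also have "\<dots> \<le> 1 * \<eta>" using t Ae pos by (intro mult_mono) auto
      finally have yy': "dist y' y \<le> \<eta>" by simp
      then have "norm y' \<le> r"
        using re yr norm_triangle_sub[of y' y] norm_ge_zero[of v] unfolding dist_norm by linarith
      then have "dist y' (metric_proj A y') \<le> \<eta>"
        using nA' metric_proj_self[OF A'(2,3) y'] by fastforce
      then have "infdist y A \<le> 2 * \<eta>"
        using yy' infdist_triangle[of y A y'] dist_metric_proj[OF A, of y']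
        by (simp add: dist_commute)
      then show ?thesis using small pos by linarith
    qed
    have yB: "\<delta> < infdist (y + v) B"
      using reg[of y] yE yA by (auto simp: not_le[symmetric])
    define z where "z = (1 - t) *\<^sub>R f + t *\<^sub>R b"
    have z: "z \<in> B''"
      unfolding z_def f_def b_def using t metric_proj_in[OF B''] by (intro convexD[OF B''(3)]) auto
    have "norm (y + v) \<le> r" using re yr pos norm_triangle_ineq[of y v] by linarith
    then have "dist (metric_proj B'' (y + v)) (metric_proj B (y + v)) \<le> \<eta>" by (rule nB'')
    then have "\<delta> - \<eta> < dist (y + v) (metric_proj B'' (y + v))"
      using yB dist_metric_proj[OF B, of "y + v"]
        dist_triangle[of "y + v" "metric_proj B (y + v)" "metric_proj B'' (y + v)"] by linarith
    also have "\<dots> \<le> dist (y + v) z" by (rule metric_proj_le[OF B'' z])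
    also have "\<dots> \<le> \<eta> + t * norm u"
    proof -
      have "dist (y + v) z = norm ((e + v - f) + t *\<^sub>R u)"
        by (simp add: dist_norm y_def z_def u_def algebra_simps)
      also have "\<dots> \<le> dist f (e + v) + t * norm u"
        using norm_triangle_ineq[of "e + v - f" "t *\<^sub>R u"] t
        by (simp add: dist_norm norm_minus_commute)
      finally show ?thesis using f by linarith
    qed
    finally have "\<delta> / 2 \<le> t * norm u" using small by linarith
    then have "\<delta> / 2 * d \<le> t * norm u * d" using d0 by (rule mult_right_mono)
    also have "\<dots> = (t * d) * norm u" by (simp add: mult_ac)
    finally have "\<delta> / 2 * d \<le> \<epsilon> * norm u" by (simp only: t(3))
    then have "\<delta> / (2 * \<epsilon>) * d \<le> norm u" using pos by (simp add: field_simps)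
    then have "(\<delta> / (2 * \<epsilon>) * d)\<^sup>2 \<le> (norm u)\<^sup>2" using pos d0 by (intro power_mono) auto
    moreover define k where "k = \<delta>\<^sup>2 / (4 * \<epsilon>\<^sup>2)"
    ultimately have u: "k * d\<^sup>2 \<le> (norm u)\<^sup>2" by (simp add: power_mult_distrib power_divide)
    have k0: "0 < k" using pos by (simp add: k_def)
    have "k * d\<^sup>2 \<le> 1 * d\<^sup>2" using u bf zero_le_power2[of "dist b f"] by linarith
    then have k1: "k \<le> 1" using de by (simp add: mult_le_cancel_right)
    have "(dist b f)\<^sup>2 \<le> (1 - k) * d\<^sup>2" using u bf by (simp add: algebra_simps)
    \<comment> \<open>A perfect square as the upper bound, so that the decrease is linear in \<open>d\<close>.\<close>
    also have "\<dots> \<le> (1 - k / 2)\<^sup>2 * d\<^sup>2"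
    proof (rule mult_right_mono)
      have "(1 - k / 2)\<^sup>2 = (1 - k) + (k / 2)\<^sup>2" by (simp add: power2_eq_square algebra_simps)
      then show "1 - k \<le> (1 - k / 2)\<^sup>2" by simp
    qed simp
    also have "\<dots> = ((1 - k / 2) * d)\<^sup>2" by (rule power_mult_distrib[symmetric])
    finally have "dist b f \<le> (1 - k / 2) * d"
      by (rule power2_le_imp_le) (use k1 d0 in simp)
    moreover have "k * \<epsilon> \<le> k * d" using k0 de by simp
    ultimately have "infdist a E \<le> d - k * \<epsilon> / 4"
      using ae small(3) by (simp add: k_def[symmetric] algebra_simps)
    then show ?thesis by (simp add: d k_def)
  qed
qed

lemma regular_imp_stable:
  assumes reg: "\<And>\<epsilon>. 0 < \<epsilon> \<Longrightarrow> \<exists>\<delta>>0. \<forall>x. max (infdist x A) (infdist (x + v) B) \<le> \<delta> \<longrightarrow> infdist x E \<le> \<epsilon>"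
    and As: "\<And>n. n \<ge> 1 \<Longrightarrow> As n \<noteq> {} \<and> closed (As n) \<and> convex (As n)"
    and Bs: "\<And>n. n \<ge> 1 \<Longrightarrow> Bs n \<noteq> {} \<and> closed (Bs n) \<and> convex (Bs n)"
    and AW: "attouch_wets As A" "attouch_wets Bs B"
    and ap: "perturbed_alternating_projections As Bs a0 a b"
  shows "(\<lambda>n. infdist (a n) E) \<longlonglongrightarrow> 0" "(\<lambda>n. infdist (b n) ((\<lambda>e. e + v) ` E)) \<longlonglongrightarrow> 0"
proof -
  obtain K where K: "\<And>e. e \<in> E \<Longrightarrow> norm e \<le> K" "0 < K" using E_bdd bounded_pos by blast
  have step: "\<exists>g>0. \<forall>\<^sub>F n in sequentially.
      infdist (a (Suc n)) E \<le> max \<epsilon> (infdist (a n) E - g)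
      \<and> infdist (b (Suc n)) ((\<lambda>e. e + v) ` E) \<le> infdist (a n) E + \<epsilon>" if "0 < \<epsilon>" for \<epsilon>
  proof -
    define \<epsilon>' where "\<epsilon>' = \<epsilon> / 2"
    have e': "0 < \<epsilon>'" using that by (simp add: \<epsilon>'_def)
    obtain \<delta> where \<delta>: "0 < \<delta>"
      "\<And>x. max (infdist x A) (infdist (x + v) B) \<le> \<delta> \<Longrightarrow> infdist x E \<le> \<epsilon>' / 2"
      using reg[of "\<epsilon>' / 2"] e' by auto
    have reg': "infdist x E < \<epsilon>'" if "max (infdist x A) (infdist (x + v) B) \<le> \<delta>" for x
      using \<delta>(2)[OF that] e' by linarith
    define g where "g = \<delta>\<^sup>2 / (4 * \<epsilon>'\<^sup>2) * \<epsilon>'"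
    have g: "0 < g" using \<delta> e' by (simp add: g_def)
    define \<eta> where "\<eta> = min (\<delta> / 4) (min (\<epsilon>' / 2) (g / 8))"
    have \<eta>: "0 < \<eta>" "\<eta> \<le> \<delta> / 4" "2 * \<eta> \<le> \<epsilon>'" "8 * \<eta> \<le> g"
      using \<delta> e' g unfolding \<eta>_def by (simp, simp, linarith, linarith)
    define r where "r = K + \<epsilon>' + norm v + \<eta>"
    have r: "0 < r" using K e' \<eta> norm_ge_zero[of v] unfolding r_def by linarith
    have rE: "norm e + \<epsilon>' + norm v + \<eta> \<le> r" if "e \<in> E" for e using K(1)[OF that] by (simp add: r_def)
    have evA: "\<forall>\<^sub>F n in sequentially. \<forall>x. norm x \<le> r \<longrightarrow> dist (metric_proj (As n) x) (metric_proj A x) \<le> \<eta>"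
      by (rule attouch_wets_metric_proj[OF A As AW(1) r \<eta>(1)])
    have evB: "\<forall>\<^sub>F n in sequentially. \<forall>x. norm x \<le> r \<longrightarrow> dist (metric_proj (Bs n) x) (metric_proj B x) \<le> \<eta>"
      by (rule attouch_wets_metric_proj[OF B Bs AW(2) r \<eta>(1)])
    have "\<forall>\<^sub>F n in sequentially. infdist (a (Suc n)) E \<le> max \<epsilon> (infdist (a n) E - g / 4)
      \<and> infdist (b (Suc n)) ((\<lambda>e. e + v) ` E) \<le> infdist (a n) E + \<epsilon>"
      using evA eventually_sequentially_Suc[THEN iffD2, OF evA]
        eventually_sequentially_Suc[THEN iffD2, OF evB] eventually_ge_at_top[of 1]
    proof eventually_elim
      case (elim n)
      have An: "As n \<noteq> {}" "closed (As n)" "convex (As n)" using As elim by blast+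
      have ASn: "As (Suc n) \<noteq> {}" "closed (As (Suc n))" "convex (As (Suc n))" using As by force+
      have BSn: "Bs (Suc n) \<noteq> {}" "closed (Bs (Suc n))" "convex (Bs (Suc n))" using Bs by force+
      have an: "a n \<in> As n"
        using ap elim(4) metric_proj_in[OF An] by (simp add: perturbed_alternating_projections_def)
      have bS: "b (Suc n) = metric_proj (Bs (Suc n)) (a n)"
        and aS: "a (Suc n) = metric_proj (As (Suc n)) (metric_proj (Bs (Suc n)) (a n))"
        using ap by (auto simp: perturbed_alternating_projections_def)
      note s = perturbed_step[OF reg' \<delta>(1) e' \<eta>(1) rE \<eta>(2,3) \<eta>(4)[unfolded g_def] An ASn BSn _ _ _ an,
          folded aS bS g_def]
      have "infdist (a (Suc n)) E \<le> max (2 * \<epsilon>') (infdist (a n) E - g / 4)"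
        by (rule s(1)) (use elim in auto)
      moreover have "infdist (b (Suc n)) ((\<lambda>e. e + v) ` E) \<le> infdist (a n) E + \<eta>"
        by (rule s(2)) (use elim in auto)
      ultimately show ?case using \<eta>(3) e' \<epsilon>'_def by simp
    qed
    then show ?thesis using g by (intro exI[of _ "g / 4"]) simp
  qed
  show lim: "(\<lambda>n. infdist (a n) E) \<longlonglongrightarrow> 0"
  proof (rule tendsto_zero_if_eventually_decreasing)
    fix \<epsilon> :: real assume "0 < \<epsilon>"
    from step[OF this] show "\<exists>g>0. \<forall>\<^sub>F n in sequentially. infdist (a (Suc n)) E \<le> max \<epsilon> (infdist (a n) E - g)"
      by (auto simp: eventually_conj_iff)
  qed (rule infdist_nonneg)
  have "(\<lambda>n. infdist (b (Suc n)) ((\<lambda>e. e + v) ` E)) \<longlonglongrightarrow> 0"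
  proof (rule order_tendstoI)
    fix c :: real assume "0 < c"
    then obtain g where "\<forall>\<^sub>F n in sequentially. infdist (b (Suc n)) ((\<lambda>e. e + v) ` E) \<le> infdist (a n) E + c / 2"
      using step[of "c / 2"] by (auto simp: eventually_conj_iff)
    moreover have "\<forall>\<^sub>F n in sequentially. infdist (a n) E < c / 2"
      by (rule order_tendstoD(2)[OF lim]) (use \<open>0 < c\<close> in simp)
    ultimately show "\<forall>\<^sub>F n in sequentially. infdist (b (Suc n)) ((\<lambda>e. e + v) ` E) < c"
      by eventually_elim simp
  qed (auto intro!: always_eventually less_le_trans[OF _ infdist_nonneg])
  then show "(\<lambda>n. infdist (b n) ((\<lambda>e. e + v) ` E)) \<longlonglongrightarrow> 0" by (rule LIMSEQ_imp_Suc)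
qed

end

section \<open>Stability implies regularity\<close>

text \<open>
  Let the differences \<open>D - C\<close> be dense in a ball around the origin, with \<open>C\<close> bounded. Mixing into
  \<open>a\<close> and \<open>b\<close> a small amount of a pair whose difference is nearly opposite to \<open>b - a\<close> halves the
  gap, at the cost of a move proportional to the gap. Iterating gives a Cauchy sequence.
\<close>

lemma common_point_near_small_gap:
  fixes C D :: "'a::{real_inner, banach} set"
  assumes C: "closed C" "convex C" and D: "closed D" "convex D"
    and R: "\<And>x. x \<in> C \<Longrightarrow> norm x \<le> R" and "0 < \<rho>"
    and ball: "cball 0 \<rho> \<subseteq> closure {b - a |b a. b \<in> D \<and> a \<in> C}"
    and a: "a \<in> C" and b: "b \<in> D"
  obtains p where "p \<in> C" "p \<in> D" "dist a p \<le> 4 * R * dist a b / \<rho>"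
proof -
  define P where "P n xy \<longleftrightarrow> fst xy \<in> C \<and> snd xy \<in> D \<and> dist (fst xy) (snd xy) \<le> dist a b / 2 ^ n" for n xy
  define Q where "Q xy xy' \<longleftrightarrow> dist (fst xy) (fst xy') \<le> 2 * R / \<rho> * dist (fst xy) (snd xy)"
    for xy xy' :: "'a \<times> 'a"
  have R0: "0 \<le> R" using R[OF a] norm_ge_zero[of a] by linarith
  have step: "\<exists>xy'. P (Suc n) xy' \<and> Q xy xy'" if "P n xy" for n xy
  proof -
    obtain x y where xy: "xy = (x, y)" by (cases xy)
    have x: "x \<in> C" and y: "y \<in> D" and n: "dist x y \<le> dist a b / 2 ^ n"
      using that by (auto simp: P_def xy)
    define z where "z = y - x"
    have "- (\<rho> *\<^sub>R sgn z) \<in> cball 0 \<rho>" using \<open>0 < \<rho>\<close> by (simp add: norm_sgn)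
    with ball have "- (\<rho> *\<^sub>R sgn z) \<in> closure {b - a |b a. b \<in> D \<and> a \<in> C}" by (rule subsetD)
    then have "\<forall>e>0. \<exists>s\<in>{b - a |b a. b \<in> D \<and> a \<in> C}. dist s (- (\<rho> *\<^sub>R sgn z)) < e"
      by (simp only: closure_approachable)
    moreover have "0 < \<rho> / 2" using \<open>0 < \<rho>\<close> by simp
    ultimately obtain s where s: "s \<in> {b - a |b a. b \<in> D \<and> a \<in> C}" "dist s (- (\<rho> *\<^sub>R sgn z)) < \<rho> / 2"
      by meson
    then obtain x' y' where x': "x' \<in> C" and y': "y' \<in> D" and s_eq: "s = y' - x'" by auto
    \<comment> \<open>The weight for which the gap would vanish if \<open>s\<close> were exactly \<open>- \<rho> *\<^sub>R sgn z\<close>.\<close>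
    define l where "l = norm z / (norm z + \<rho>)"
    have zr: "0 < norm z + \<rho>" using \<open>0 < \<rho>\<close> norm_ge_zero[of z] by linarith
    have l: "0 \<le> l" "l \<le> 1" "l * \<rho> \<le> norm z" "(1 - l) * norm z = l * \<rho>"
      using zr \<open>0 < \<rho>\<close> by (auto simp: l_def field_simps)
    define x1 where "x1 = (1 - l) *\<^sub>R x + l *\<^sub>R x'"
    define y1 where "y1 = (1 - l) *\<^sub>R y + l *\<^sub>R y'"
    have x1: "x1 \<in> C" and y1: "y1 \<in> D"
      unfolding x1_def y1_def using l x x' y y' by (auto intro!: convexD[OF C(2)] convexD[OF D(2)])
    have zs: "z = norm z *\<^sub>R sgn z" by (cases "z = 0") (simp_all add: sgn_div_norm)
    have "(1 - l) *\<^sub>R z = (l * \<rho>) *\<^sub>R sgn z"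
      using arg_cong[OF zs, of "(*\<^sub>R) (1 - l)"] by (simp only: scaleR_scaleR l(4))
    then have "y1 - x1 = l *\<^sub>R (s - - (\<rho> *\<^sub>R sgn z))"
      by (simp add: x1_def y1_def s_eq z_def algebra_simps)
    then have "dist x1 y1 = l * dist s (- (\<rho> *\<^sub>R sgn z))"
      using l by (simp add: dist_norm norm_minus_commute[of x1 y1])
    also have "\<dots> \<le> l * (\<rho> / 2)" using s l by (intro mult_left_mono) auto
    also have "\<dots> \<le> dist x y / 2" using l(3) by (simp add: z_def dist_norm norm_minus_commute)
    also have "\<dots> \<le> dist a b / 2 ^ Suc n" using n by simp
    finally have "P (Suc n) (x1, y1)" using x1 y1 by (simp add: P_def)
    moreover have "Q xy (x1, y1)"
    proof -
      have "x - x1 = l *\<^sub>R (x - x')" by (simp add: x1_def algebra_simps)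
      then have "dist x x1 = l * norm (x - x')" using l by (simp add: dist_norm)
      also have "\<dots> \<le> l * (2 * R)"
        using norm_triangle_ineq4[of x x'] R[OF x] R[OF x'] l by (intro mult_left_mono) auto
      also have "\<dots> \<le> 2 * R / \<rho> * norm z"
        using mult_right_mono[OF l(3), of "2 * R"] R0 \<open>0 < \<rho>\<close> by (simp add: field_simps)
      finally show ?thesis by (simp add: Q_def xy z_def dist_norm norm_minus_commute)
    qed
    ultimately show ?thesis by blast
  qed
  have "\<exists>f. \<forall>n. (P n (f n) \<and> (n = 0 \<longrightarrow> f n = (a, b))) \<and> Q (f n) (f (Suc n))"
  proof (rule dependent_nat_choice)
    show "\<exists>xy. P 0 xy \<and> (0 = 0 \<longrightarrow> xy = (a, b))" using a b by (simp add: P_def)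
    show "\<exists>xy'. (P (Suc n) xy' \<and> (Suc n = 0 \<longrightarrow> xy' = (a, b))) \<and> Q xy xy'"
      if "P n xy \<and> (n = 0 \<longrightarrow> xy = (a, b))" for n xy
      using step[of n xy] that by simp
  qed
  then obtain f where f: "f 0 = (a, b)" "\<And>n. P n (f n)" "\<And>n. Q (f n) (f (Suc n))" by blast
  define x where "x n = fst (f n)" for n
  define y where "y n = snd (f n)" for n
  define c where "c = 2 * R / \<rho> * dist a b"
  have c0: "0 \<le> c" using R0 \<open>0 < \<rho>\<close> by (simp add: c_def)
  have xC: "x n \<in> C" and yD: "y n \<in> D" and xy: "dist (x n) (y n) \<le> dist a b / 2 ^ n" for n
    using f(2)[of n] by (auto simp: P_def x_def y_def)
  have xx: "norm (x (Suc n) - x n) \<le> c * (1 / 2) ^ n" for n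
  proof -
    have "norm (x (Suc n) - x n) \<le> 2 * R / \<rho> * dist (x n) (y n)"
      using f(3)[of n] by (simp add: Q_def x_def y_def dist_norm norm_minus_commute)
    also have "\<dots> \<le> 2 * R / \<rho> * (dist a b / 2 ^ n)"
      using R0 \<open>0 < \<rho>\<close> xy by (intro mult_left_mono) auto
    finally show ?thesis by (simp add: c_def power_one_over divide_simps)
  qed
  have geo: "(\<lambda>n. c * (1 / 2) ^ n) sums (c * 2)"
    using sums_mult[OF geometric_sums[of "1/2 :: real"], of c] by simp
  have "summable (\<lambda>n. norm (x (Suc n) - x n))"
    by (rule summable_comparison_test'[OF sums_summable[OF geo], of 0]) (use xx in simp)
  then have sm: "summable (\<lambda>n. x (Suc n) - x n)" by (rule summable_norm_cancel)
  define S where "S = (\<Sum>n. x (Suc n) - x n)"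
  have "(\<lambda>n. \<Sum>i<n. x (Suc i) - x i) \<longlonglongrightarrow> S"
    using sm by (simp add: S_def summable_LIMSEQ)
  then have "(\<lambda>n. x n - a) \<longlonglongrightarrow> S"
    by (simp add: sum_lessThan_telescope) (simp add: x_def f(1))
  from tendsto_add[OF tendsto_const[of a] this] have lim: "x \<longlonglongrightarrow> a + S" by simp
  have "(\<lambda>n. dist a b / 2 ^ n) \<longlonglongrightarrow> 0"
    using tendsto_mult_right_zero[OF LIMSEQ_realpow_zero[of "1/2 :: real"], of "dist a b"]
    by (simp add: power_one_over)
  then have "(\<lambda>n. y n - x n) \<longlonglongrightarrow> 0"
    by (rule Lim_null_comparison[rotated]) (use xy in \<open>auto simp: dist_norm norm_minus_commute\<close>)
  from tendsto_add[OF this lim] have limy: "y \<longlonglongrightarrow> a + S" by simp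
  have "a + S \<in> C" by (rule closed_sequentially[OF C(1) _ lim]) (rule xC)
  moreover have "a + S \<in> D" by (rule closed_sequentially[OF D(1) _ limy]) (rule yD)
  moreover have "norm S \<le> c * 2"
    unfolding S_def by (rule norm_suminf_le[OF xx sums_summable[OF geo], folded sums_unique[OF geo]])
  then have "dist a (a + S) \<le> 4 * R * dist a b / \<rho>"
    by (simp add: dist_norm c_def)
  ultimately show ?thesis using that by blast
qed

text \<open>
  A pair of convex sets whose alternating projections are trapped: the hyperplane
  \<open>inner h z = c\<close> is touched by \<open>C\<close> at the single point \<open>x\<close>, and in such a way that the distance
  to \<open>x\<close> is at most \<open>K\<close> times the distance to the hyperplane. Along the iteration the gaps between
  consecutive projections tend to \<open>v\<close>, which forces the points of \<open>C\<close> towards the hyperplane.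
\<close>

lemma alternating_projections_trapped:
  fixes C D :: "'a::{real_inner, banach} set"
  assumes C: "closed C" "convex C" and D: "closed D" "convex D"
    and x: "x \<in> C" "x + v \<in> D" "inner h x = c"
    and h: "norm h = 1" "v = norm v *\<^sub>R h" and K: "0 < K"
    and CK: "\<And>z. z \<in> C \<Longrightarrow> dist z x \<le> K * (c - inner h z)"
    and Dh: "\<And>z. z \<in> D \<Longrightarrow> c + norm v \<le> inner h z"
    and a: "\<And>n. a (Suc n) = metric_proj C (metric_proj D (a n))"
  shows "a \<longlonglongrightarrow> x"
proof -
  have C': "C \<noteq> {}" "closed C" "convex C" and D': "D \<noteq> {}" "closed D" "convex D"
    using C D x by blast+
  have vh: "inner v z = norm v * inner h z" for z
    using arg_cong[OF h(2), of "\<lambda>y. inner y z"] by simp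
  have hh: "inner h h = 1" using h(1) by (simp add: norm_eq_1)
  have hv: "inner h v = norm v" using vh[of h] hh by (simp add: inner_commute)
  have Dx: "metric_proj D x = x + v"
  proof (rule metric_proj_eqI[OF D x(2)])
    fix y assume "y \<in> D"
    then have "norm v * (c + norm v) \<le> norm v * inner h y" by (intro mult_left_mono Dh) auto
    then show "inner (x - (x + v)) (y - (x + v)) \<le> 0"
      by (simp add: inner_diff inner_add vh x(3) hv algebra_simps)
  qed
  have Cx: "metric_proj C (x + v) = x"
  proof (rule metric_proj_eqI[OF C x(1)])
    fix y assume "y \<in> C"
    then have "0 \<le> K * (c - inner h y)" using CK[of y] zero_le_dist[of y x] by linarith
    then have "0 \<le> c - inner h y" using K by (simp add: zero_le_mult_iff)
    then have "norm v * inner h y \<le> norm v * c" by (intro mult_left_mono) auto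
    then show "inner (x + v - x) (y - x) \<le> 0"
      by (simp add: inner_diff vh x(3))
  qed
  define b where "b n = metric_proj D (a n)" for n
  have gap: "(norm (a n - b n + v))\<^sup>2 \<le> (dist (a n) x)\<^sup>2 - (dist (a (Suc n)) x)\<^sup>2" for n
  proof -
    have "(dist (b n) (x + v))\<^sup>2 + (norm (a n - b n + v))\<^sup>2 \<le> (dist (a n) x)\<^sup>2"
      using metric_proj_firmly_nonexpansive[OF D', of "a n" x] by (simp add: Dx b_def dist_norm)
    moreover have "dist (a (Suc n)) x \<le> dist (b n) (x + v)"
      using metric_proj_nonexpansive[OF C', of "b n" "x + v"] by (simp add: Cx b_def a)
    then have "(dist (a (Suc n)) x)\<^sup>2 \<le> (dist (b n) (x + v))\<^sup>2" by (intro power_mono) auto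
    ultimately show ?thesis by linarith
  qed
  define s where "s n = (dist (a n) x)\<^sup>2" for n
  have "decseq s"
  proof (rule decseq_SucI)
    show "s (Suc n) \<le> s n" for n
      using gap[of n] zero_le_power2[of "norm (a n - b n + v)"] unfolding s_def by linarith
  qed
  then obtain L where L: "s \<longlonglongrightarrow> L"
    using decseq_convergent[of s 0] by (auto simp: s_def)
  have "(\<lambda>n. s n - s (Suc n)) \<longlonglongrightarrow> 0" using tendsto_diff[OF L LIMSEQ_Suc[OF L]] by simp
  then have "(\<lambda>n. (norm (a n - b n + v))\<^sup>2) \<longlonglongrightarrow> 0"
    by (rule Lim_null_comparison[rotated]) (use gap in \<open>auto simp: s_def\<close>)
  then have g0: "(\<lambda>n. norm (a n - b n + v)) \<longlonglongrightarrow> 0"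
    using tendsto_real_sqrt[of "\<lambda>n. (norm (a n - b n + v))\<^sup>2" 0] by simp
  have "dist (a n) x \<le> K * norm (a n - b n + v)" if "n \<ge> 1" for n
  proof -
    have "a n \<in> C" using that a metric_proj_in[OF C'] by (cases n) auto
    then have "dist (a n) x \<le> K * (c - inner h (a n))" by (rule CK)
    also have "\<dots> \<le> K * norm (a n - b n + v)"
    proof (intro mult_left_mono)
      have "c + norm v \<le> inner h (b n)" using Dh metric_proj_in[OF D'] by (simp add: b_def)
      then have "c - inner h (a n) \<le> inner h (- (a n - b n + v))"
        by (simp add: inner_diff inner_add hv)
      also have "\<dots> \<le> norm (a n - b n + v)"
        using norm_cauchy_schwarz[of h "- (a n - b n + v)"] h(1) by (simp only: norm_minus_cancel mult_1)
      finally show "c - inner h (a n) \<le> norm (a n - b n + v)" .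
    qed (use K in simp)
    finally show ?thesis .
  qed
  then have "\<forall>\<^sub>F n in sequentially. norm (dist (a n) x) \<le> K * norm (a n - b n + v)"
    by (auto intro: eventually_sequentiallyI[of 1])
  from Lim_null_comparison[OF this tendsto_mult_right_zero[OF g0]]
  show ?thesis by (rule tendsto_dist_iff[THEN iffD2])
qed

context convex_pair
begin

text \<open>
  A failure of regularity is witnessed in a fixed ball: since \<open>E\<close> is bounded, a point far from
  \<open>E\<close> but near \<open>A\<close> and \<open>B - v\<close> can be moved towards its projection to \<open>E\<close>, which keeps it near
  both sets.
\<close>

lemma nonregular_witnesses:
  assumes "0 < \<epsilon>"
    and nonreg: "\<And>\<delta>. 0 < \<delta> \<Longrightarrow> \<exists>x. infdist x A \<le> \<delta> \<and> infdist (x + v) B \<le> \<delta> \<and> \<epsilon> < infdist x E"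
  obtains r where "0 < r"
    "\<And>\<delta>. 0 < \<delta> \<Longrightarrow> \<exists>a\<in>A. \<exists>b\<in>B. norm a \<le> r \<and> norm b \<le> r \<and> norm (b - v - a) \<le> \<delta> \<and> \<epsilon> / 2 \<le> infdist a E"
proof -
  obtain K where K: "\<And>e. e \<in> E \<Longrightarrow> norm e \<le> K" "0 < K" using E_bdd bounded_pos by blast
  define r where "r = K + 2 * \<epsilon> + norm v"
  have "\<exists>a\<in>A. \<exists>b\<in>B. norm a \<le> r \<and> norm b \<le> r \<and> norm (b - v - a) \<le> \<delta> \<and> \<epsilon> / 2 \<le> infdist a E"
    if "0 < \<delta>" for \<delta>
  proof -
    define \<delta>' where "\<delta>' = min (\<delta> / 2) (\<epsilon> / 2)"
    have \<delta>': "0 < \<delta>'" "\<delta>' \<le> \<delta> / 2" "\<delta>' \<le> \<epsilon> / 2" using that \<open>0 < \<epsilon>\<close> by (auto simp: \<delta>'_def)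
    obtain x where x: "infdist x A \<le> \<delta>'" "infdist (x + v) B \<le> \<delta>'" "\<epsilon> < infdist x E"
      using nonreg[OF \<delta>'(1)] by blast
    define e where "e = metric_proj E x"
    have e: "e \<in> E" "dist x e = infdist x E"
      unfolding e_def by (auto intro: metric_proj_in[OF E] dist_metric_proj[OF E])
    define t where "t = \<epsilon> / dist x e"
    have t: "0 < t" "t \<le> 1" "t * dist x e = \<epsilon>" using x e(2) \<open>0 < \<epsilon>\<close> by (auto simp: t_def)
    define y where "y = (1 - t) *\<^sub>R e + t *\<^sub>R x"
    define a where "a = (1 - t) *\<^sub>R e + t *\<^sub>R metric_proj A x"
    define b where "b = (1 - t) *\<^sub>R (e + v) + t *\<^sub>R metric_proj B (x + v)"
    have a: "a \<in> A" unfolding a_def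
      using t e metric_proj_in[OF A] by (intro convexD[OF A(3)]) (auto simp: E_eq)
    have b: "b \<in> B" unfolding b_def
      using t e metric_proj_in[OF B] by (intro convexD[OF B(3)]) (auto simp: E_eq)
    have td: "t * s \<le> \<delta>'" if "s \<le> \<delta>'" for s
      using mult_left_mono[OF that, of t] mult_left_le_one_le[of \<delta>' t] t \<delta>' by linarith
    have "y - a = t *\<^sub>R (x - metric_proj A x)" by (simp add: y_def a_def algebra_simps)
    then have ya: "dist y a \<le> \<delta>'"
      using t td x(1) dist_metric_proj[OF A, of x] by (simp add: dist_norm)
    have "y + v - b = t *\<^sub>R (x + v - metric_proj B (x + v))"
      by (simp add: y_def b_def algebra_simps)
    then have yb: "norm (y + v - b) \<le> \<delta>'"
      using t td x(2) dist_metric_proj[OF B, of "x + v"] by (simp add: dist_norm)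
    have "y - e = t *\<^sub>R (x - e)" by (simp add: y_def algebra_simps)
    then have ye: "norm (y - e) = \<epsilon>" using t by (simp add: dist_norm)
    have "x - y = (1 - t) *\<^sub>R (x - e)" by (simp add: y_def algebra_simps)
    then have "dist x y = (1 - t) * dist x e" using t by (simp add: dist_norm)
    then have "\<epsilon> \<le> infdist y E"
      using infdist_triangle[of x E y] e t by (simp add: algebra_simps)
    then have "\<epsilon> / 2 \<le> infdist a E" using infdist_triangle[of y E a] ya \<delta>' by linarith
    moreover have "norm a \<le> r"
      using norm_triangle_sub[of a y] norm_triangle_sub[of y e] ya ye K(1)[OF e(1)] \<delta>' \<open>0 < \<epsilon>\<close>
        norm_ge_zero[of v] unfolding r_def dist_norm norm_minus_commute[of y a] by linarith
    moreover have "norm b \<le> r"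
      using norm_triangle_sub[of b "y + v"] norm_triangle_ineq[of y v] norm_triangle_sub[of y e] yb ye
        K(1)[OF e(1)] \<delta>' \<open>0 < \<epsilon>\<close> unfolding r_def norm_minus_commute[of "y + v" b] by linarith
    moreover have "norm (b - v - a) \<le> \<delta>"
      using norm_triangle_ineq4[of "y - a" "y + v - b"] ya yb \<delta>'
      by (simp add: dist_norm algebra_simps)
    ultimately show ?thesis using a b by blast
  qed
  moreover have "0 < r" using K \<open>0 < \<epsilon>\<close> norm_ge_zero[of v] unfolding r_def by linarith
  ultimately show ?thesis using that by blast
qed

end

lemma convex_dist_le_linear:
  fixes x h :: "'a::real_inner"
  assumes "0 \<le> K"
  shows "convex {z. dist z x \<le> K * (c - inner h z)}"
proof (rule convexI)
  fix y z and s t :: real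
  assume yz: "y \<in> {z. dist z x \<le> K * (c - inner h z)}" "z \<in> {z. dist z x \<le> K * (c - inner h z)}"
    and st: "0 \<le> s" "0 \<le> t" "s + t = 1"
  have s: "s = 1 - t" using st by simp
  have "dist (s *\<^sub>R y + t *\<^sub>R z) x = norm (s *\<^sub>R (y - x) + t *\<^sub>R (z - x))"
    by (simp add: s dist_norm algebra_simps)
  also have "\<dots> \<le> s * dist y x + t * dist z x"
    by (rule norm_triangle_le) (use st in \<open>simp add: dist_norm\<close>)
  also have "\<dots> \<le> s * (K * (c - inner h y)) + t * (K * (c - inner h z))"
    using yz st by (intro add_mono mult_left_mono) auto
  also have "\<dots> = K * (c - inner h (s *\<^sub>R y + t *\<^sub>R z))"
    by (simp add: s inner_add algebra_simps)
  finally show "s *\<^sub>R y + t *\<^sub>R z \<in> {z. dist z x \<le> K * (c - inner h z)}" by simp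
qed

text \<open>
  Running through infinitely many convergent iterations one after the other: the iteration \<open>T k\<close>
  is applied until the orbit is close to its limit \<open>x k\<close>, and then the next one takes over. The
  orbit is close to one of these limits infinitely often, while every single iteration is used for a
  finite time only.
\<close>

lemma concatenated_iterations:
  fixes T :: "nat \<Rightarrow> 'a::metric_space \<Rightarrow> 'a"
  assumes T: "\<And>k a. (\<And>n. a (Suc n) = T k (a n)) \<Longrightarrow> a \<longlonglongrightarrow> x k" and "0 < e"
  obtains phase a where "a 0 = a0" "\<And>n. a (Suc n) = T (phase n) (a n)"
    "filterlim phase at_top sequentially"
    "\<And>N. \<exists>n\<ge>N. dist (a (Suc n)) (x (phase n)) < e"
proof -
  define s where "s = rec_nat (0, a0)
    (\<lambda>_ (k, y). (if dist (T k y) (x k) < e then Suc k else k, T k y))"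
  define phase where "phase n = fst (s n)" for n
  define a where "a n = snd (s n)" for n
  have a0: "a 0 = a0" by (simp add: a_def s_def)
  have aS: "a (Suc n) = T (phase n) (a n)" for n
    by (simp add: a_def phase_def s_def case_prod_beta)
  have pS: "phase (Suc n) = (if dist (a (Suc n)) (x (phase n)) < e then Suc (phase n) else phase n)" for n
    unfolding aS by (simp add: a_def phase_def s_def case_prod_beta)
  have close: "\<exists>n\<ge>N. dist (a (Suc n)) (x (phase n)) < e" for N
  proof (rule ccontr)
    assume no: "\<not> ?thesis"
    then have far: "\<not> dist (a (Suc (N + j))) (x (phase (N + j))) < e" for j by simp
    have const: "phase (N + j) = phase N" for j
    proof (induction j)
      case (Suc j)
      then show ?case using pS[of "N + j"] far[of j] by simp
    qed simp
    have "(\<lambda>j. a (N + j)) \<longlonglongrightarrow> x (phase N)"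
      by (rule T) (simp add: aS const)
    then have "(\<lambda>j. a (N + Suc j)) \<longlonglongrightarrow> x (phase N)" by (rule LIMSEQ_Suc)
    then have "\<forall>\<^sub>F j in sequentially. dist (a (N + Suc j)) (x (phase N)) < e"
      using \<open>0 < e\<close> by (rule tendstoD)
    then obtain j where "dist (a (N + Suc j)) (x (phase N)) < e"
      by (auto simp: eventually_sequentially)
    then show False using far[of j] const[of j] by simp
  qed
  have mono: "incseq phase" by (rule incseq_SucI) (simp add: pS)
  have "\<exists>n. k \<le> phase n" for k
  proof (induction k)
    case (Suc k)
    then obtain n where n: "k \<le> phase n" by blast
    obtain m where m: "m \<ge> n" "dist (a (Suc m)) (x (phase m)) < e" using close by blast
    have "k \<le> phase m" using n incseqD[OF mono m(1)] by linarith
    then have "Suc k \<le> phase (Suc m)" using m(2) by (simp add: pS)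
    then show ?case by blast
  qed simp
  then have "\<forall>k. \<forall>\<^sub>F n in sequentially. k \<le> phase n"
    using incseqD[OF mono] by (meson eventually_sequentiallyI order_trans)
  then have "filterlim phase at_top sequentially" by (simp add: filterlim_at_top)
  from that[OF a0 aS this close] show ?thesis .
qed

context convex_pair
begin

text \<open>
  After an arbitrarily small shift, large bounded parts of \<open>A\<close> and \<open>B - v\<close> are strictly separated.
  If \<open>v\<close> is nonzero, it is itself the direction in which \<open>A\<close> can be moved away from \<open>B\<close>. If \<open>v\<close> is
  zero and no small shift separates, the differences of the two parts are dense around the origin,
  so that points of \<open>A\<close> and \<open>B\<close> that are close to each other are close to \<open>A \<inter> B = E\<close>, against the
  failure of regularity.
\<close>

lemma small_shift_separates:
  assumes "0 < \<epsilon>" "r \<le> R" "0 < \<eta>"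
    and wit: "\<And>\<delta>. 0 < \<delta> \<Longrightarrow>
      \<exists>a\<in>A. \<exists>b\<in>B. norm a \<le> r \<and> norm b \<le> r \<and> norm (b - v - a) \<le> \<delta> \<and> \<epsilon> \<le> infdist a E"
  obtains w h \<mu> where "norm w \<le> \<eta>" "norm h = 1" "v = norm v *\<^sub>R h" "0 < \<mu>"
    "\<And>a b. a \<in> A \<Longrightarrow> norm a \<le> R \<Longrightarrow> b \<in> B \<Longrightarrow> norm b \<le> R \<Longrightarrow> \<mu> \<le> inner h (b - v - a - w)"
proof (cases "v = 0")
  case False
  define h where "h = (1 / norm v) *\<^sub>R v"
  have h: "norm h = 1" "v = norm v *\<^sub>R h" using False by (auto simp: h_def)
  have hv: "inner h z = inner v z / norm v" for z by (simp add: h_def)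
  have "\<eta> \<le> inner h (b - v - a - - (\<eta> *\<^sub>R h))" if "a \<in> A" "b \<in> B" for a b
  proof -
    have "inner v v / norm v \<le> inner v (b - a) / norm v"
      using inner_ge[OF that] by (simp add: power2_norm_eq_inner divide_right_mono)
    then have "inner h v \<le> inner h (b - a)" by (simp only: hv)
    moreover have "inner h h = 1" using h(1) by (simp add: norm_eq_1)
    ultimately show ?thesis by (simp add: inner_diff inner_add)
  qed
  with that[of "- (\<eta> *\<^sub>R h)" h \<eta>] h \<open>0 < \<eta>\<close> show ?thesis by simp
next
  case True
  define C where "C = A \<inter> cball 0 R"
  define D where "D = B \<inter> cball 0 R"
  define S where "S = {b - a |b a. b \<in> D \<and> a \<in> C}"
  have C: "closed C" "convex C" and D: "closed D" "convex D"
    unfolding C_def D_def using A B by (auto intro!: closed_Int convex_Int)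
  have "\<not> cball 0 \<eta> \<subseteq> closure S"
  proof
    assume ball: "cball 0 \<eta> \<subseteq> closure S"
    \<comment> \<open>For a gap of at most \<open>\<delta>\<close> the common point is at distance less than \<open>\<epsilon>\<close>.\<close>
    define \<delta> where "\<delta> = \<epsilon> * \<eta> / (8 * (\<bar>R\<bar> + 1))"
    have \<delta>: "0 < \<delta>" using assms(1,3) by (simp add: \<delta>_def add_nonneg_pos)
    obtain a b where ab: "a \<in> A" "b \<in> B" "norm a \<le> r" "norm b \<le> r" "norm (b - v - a) \<le> \<delta>"
      "\<epsilon> \<le> infdist a E" using wit[OF \<delta>] by blast
    have aC: "a \<in> C" and bD: "b \<in> D" using ab \<open>r \<le> R\<close> by (auto simp: C_def D_def)
    have R: "norm x \<le> R" if "x \<in> C" for x using that by (simp add: C_def)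
    have R0: "0 \<le> R" using R[OF aC] norm_ge_zero[of a] by linarith
    obtain p where p: "p \<in> C" "p \<in> D" "dist a p \<le> 4 * R * dist a b / \<eta>"
      using common_point_near_small_gap[OF C D R \<open>0 < \<eta>\<close> ball[unfolded S_def] aC bD] by blast
    have "p \<in> E" using p by (simp add: E_eq C_def D_def True)
    then have "\<epsilon> \<le> dist a p" using infdist_le[of p E a] ab(6) by linarith
    also have "\<dots> \<le> 4 * R * \<delta> / \<eta>"
    proof -
      have "4 * R * dist a b / \<eta> \<le> 4 * R * \<delta> / \<eta>"
        using ab(5) R0 \<open>0 < \<eta>\<close>
        by (intro divide_right_mono mult_left_mono) (auto simp: True dist_norm norm_minus_commute)
      with p(3) show ?thesis by linarith
    qed
    also have "\<dots> < \<epsilon>"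
    proof -
      have "8 * (R + 1) * \<delta> = \<epsilon> * \<eta>" using R0 by (simp add: \<delta>_def)
      moreover have "8 * (R + 1) * \<delta> = 4 * R * \<delta> + (4 * (R * \<delta>) + 8 * \<delta>)"
        by (simp add: algebra_simps)
      moreover have "0 \<le> R * \<delta>" using R0 \<delta> by simp
      ultimately have "4 * R * \<delta> < \<epsilon> * \<eta>" using \<delta> by linarith
      then show ?thesis using \<open>0 < \<eta>\<close> by (simp add: divide_less_eq)
    qed
    finally show False by simp
  qed
  then obtain w where "w \<in> cball 0 \<eta>" and wS: "w \<notin> closure S" by blast
  then have w: "norm w \<le> \<eta>" by simp
  have memS: "b - a \<in> S" if "a \<in> A" "norm a \<le> R" "b \<in> B" "norm b \<le> R" for a b
    unfolding S_def C_def D_def using that by (intro CollectI exI[of _ b] exI[of _ a]) simp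
  obtain a b where "a \<in> A" "b \<in> B" "norm a \<le> r" "norm b \<le> r" using wit[of 1] by auto
  then have "b - a \<in> S" using \<open>r \<le> R\<close> by (intro memS) auto
  then have S: "closure S \<noteq> {}" "closed (closure S)" "convex (closure S)"
    using convex_minkowski_differences[OF C(2) D(2)] by (auto simp: S_def intro!: convex_closure)
  define p where "p = metric_proj (closure S) w"
  define u where "u = p - w"
  have u: "u \<noteq> 0" using metric_proj_in[OF S, of w] wS by (auto simp: u_def p_def)
  have sep: "norm u \<le> inner ((1 / norm u) *\<^sub>R u) (b - v - a - w)"
    if "a \<in> A" "norm a \<le> R" "b \<in> B" "norm b \<le> R" for a b
  proof -
    have "inner (w - p) (b - a - p) \<le> 0"
      unfolding p_def using closure_subset memS[OF that] by (intro metric_proj_inner_le[OF S]) auto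
    moreover have "w - p = - u" "b - a - p = (b - a - w) - u" by (simp_all add: u_def)
    ultimately have "inner u u \<le> inner u (b - a - w)" by (simp only: inner_minus_left inner_diff_right)
    then have "norm u * norm u \<le> inner u (b - a - w)"
      by (simp only: power2_norm_eq_inner flip: power2_eq_square)
    then show ?thesis using u by (simp add: True field_simps)
  qed
  show ?thesis
    by (rule that[OF w _ _ _ sep]) (use u in \<open>auto simp: True\<close>)
qed

text \<open>
  The trap near a witness of nonregularity. Truncate \<open>A\<close> and \<open>B\<close> to a large ball and shift the first
  part such that it is separated from the second one moved by \<open>-v\<close>; then join to the two parts the
  points \<open>x\<close> and \<open>x + v\<close>, with \<open>x\<close> near the witness and on the hyperplane orthogonal to \<open>h\<close> that
  supports the second part moved by \<open>-v\<close>. The shifted part of \<open>A\<close> is bounded and stays strictly below this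
  hyperplane, which yields the linear estimate that traps the alternating projections.
\<close>

lemma trap_exists:
  assumes "0 < \<epsilon>" "r \<le> R" "0 < \<eta>"
    and wit: "\<And>\<delta>. 0 < \<delta> \<Longrightarrow>
      \<exists>a\<in>A. \<exists>b\<in>B. norm a \<le> r \<and> norm b \<le> r \<and> norm (b - v - a) \<le> \<delta> \<and> \<epsilon> \<le> infdist a E"
  obtains C D x where "C \<noteq> {}" "closed C" "convex C" "D \<noteq> {}" "closed D" "convex D"
    "\<And>z. z \<in> C \<Longrightarrow> infdist z A \<le> 4 * \<eta>" "\<And>z. z \<in> A \<Longrightarrow> norm z \<le> R \<Longrightarrow> infdist z C \<le> 4 * \<eta>"
    "\<And>z. z \<in> D \<Longrightarrow> infdist z B \<le> 4 * \<eta>" "\<And>z. z \<in> B \<Longrightarrow> norm z \<le> R \<Longrightarrow> infdist z D \<le> 4 * \<eta>"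
    "\<epsilon> - 3 * \<eta> \<le> infdist x E"
    "\<And>a. (\<And>n. a (Suc n) = metric_proj C (metric_proj D (a n))) \<Longrightarrow> a \<longlonglongrightarrow> x"
proof -
  obtain w h \<mu> where w: "norm w \<le> \<eta>" and h: "norm h = 1" "v = norm v *\<^sub>R h" and \<mu>: "0 < \<mu>"
    and sep: "\<And>a b. a \<in> A \<Longrightarrow> norm a \<le> R \<Longrightarrow> b \<in> B \<Longrightarrow> norm b \<le> R \<Longrightarrow> \<mu> \<le> inner h (b - v - a - w)"
    using small_shift_separates[OF assms] by blast
  obtain a b where ab: "a \<in> A" "b \<in> B" "norm a \<le> r" "norm b \<le> r" "norm (b - v - a) \<le> \<eta>"
      "\<epsilon> \<le> infdist a E" using wit[OF \<open>0 < \<eta>\<close>] by blast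
  have abR: "norm a \<le> R" "norm b \<le> R" using ab \<open>r \<le> R\<close> by auto
  have hh: "inner h h = 1" using h(1) by (simp add: norm_eq_1)
  have hv: "inner h v = norm v" using hh arg_cong[OF h(2), of "inner h"] by simp
  define B0 where "B0 = B \<inter> cball 0 R"
  define c where "c = (INF z\<in>B0. inner h (z - v))"
  have bB0: "b \<in> B0" using ab abR by (simp add: B0_def)
  have low: "inner h (z + w) + \<mu> \<le> inner h (z' - v)" if "z \<in> A" "norm z \<le> R" "z' \<in> B0" for z z'
    using sep[of z z'] that by (simp add: B0_def inner_diff inner_add)
  have c_ge: "inner h (z + w) + \<mu> \<le> c" if "z \<in> A" "norm z \<le> R" for z
    unfolding c_def using bB0 low[OF that] by (intro cINF_greatest) auto
  have c_le: "c \<le> inner h (z - v)" if "z \<in> B0" for z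
    unfolding c_def using that low[OF ab(1) abR(1)] by (intro cINF_lower bdd_belowI2) auto
  define s where "s = c - inner h (a + w)"
  have s0: "0 \<le> s" using c_ge[OF ab(1) abR(1)] \<mu> by (simp add: s_def)
  have "s \<le> inner h (b - v - a - w)" using c_le[OF bB0] by (simp add: s_def inner_diff inner_add)
  also have "\<dots> \<le> norm (b - v - a - w)" using norm_cauchy_schwarz[of h "b - v - a - w"] h(1) by simp
  also have "\<dots> \<le> 2 * \<eta>" using norm_triangle_ineq4[of "b - v - a" w] ab(5) w by linarith
  finally have s2: "s \<le> 2 * \<eta>" .
  define x where "x = a + w + s *\<^sub>R h"
  have hx: "inner h x = c" by (simp add: x_def s_def inner_add hh)
  have ns: "norm (s *\<^sub>R h) \<le> 2 * \<eta>" using s0 s2 h(1) by simp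
  have xa: "dist x a \<le> 3 * \<eta>"
    using norm_triangle_ineq[of w "s *\<^sub>R h"] w ns by (simp add: x_def dist_norm)
  have xb: "dist (x + v) b \<le> 4 * \<eta>"
  proof -
    have "x + v - b = (w + s *\<^sub>R h) - (b - v - a)" by (simp add: x_def algebra_simps)
    then have "dist (x + v) b \<le> norm (w + s *\<^sub>R h) + norm (b - v - a)"
      using norm_triangle_ineq4[of "w + s *\<^sub>R h" "b - v - a"] by (simp only: dist_norm)
    then show ?thesis using norm_triangle_ineq[of w "s *\<^sub>R h"] w ns ab(5) by linarith
  qed
  define A1 where "A1 = insert x ((\<lambda>z. z + w) ` (A \<inter> cball 0 R))"
  define B1 where "B1 = insert (x + v) B0"
  define C where "C = closure (convex hull A1)"
  define D where "D = closure (convex hull B1)"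
  have A1C: "A1 \<subseteq> C" and B1D: "B1 \<subseteq> D"
    unfolding C_def D_def by (meson closure_subset hull_subset order_trans)+
  have xC: "x \<in> C" and xvD: "x + v \<in> D" using A1C B1D by (auto simp: A1_def B1_def)
  have C: "C \<noteq> {}" "closed C" "convex C" and D: "D \<noteq> {}" "closed D" "convex D"
    using xC xvD by (auto simp: C_def D_def intro!: convex_closure)
  have CA: "C \<subseteq> {z. infdist z A \<le> 4 * \<eta>}"
    unfolding C_def
  proof (rule closure_convex_hull_minimal[OF _ closed_infdist_le convex_infdist_le[OF A]])
    have "infdist (z + w) A \<le> 4 * \<eta>" if "z \<in> A" for z
      using that w \<open>0 < \<eta>\<close> by (intro infdist_le2[of z]) (auto simp: dist_norm)
    moreover have "infdist x A \<le> 4 * \<eta>"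
      using infdist_le2[OF ab(1) xa] \<open>0 < \<eta>\<close> by linarith
    ultimately show "A1 \<subseteq> {z. infdist z A \<le> 4 * \<eta>}" by (auto simp: A1_def)
  qed
  have DB: "D \<subseteq> {z. infdist z B \<le> 4 * \<eta>}"
    unfolding D_def
  proof (rule closure_convex_hull_minimal[OF _ closed_infdist_le convex_infdist_le[OF B]])
    show "B1 \<subseteq> {z. infdist z B \<le> 4 * \<eta>}"
      using infdist_le2[OF ab(2) xb] \<open>0 < \<eta>\<close> by (auto simp: B1_def B0_def)
  qed
  have AC: "infdist z C \<le> 4 * \<eta>" if "z \<in> A" "norm z \<le> R" for z
  proof (rule infdist_le2)
    show "z + w \<in> C" using A1C that by (auto simp: A1_def)
    show "dist z (z + w) \<le> 4 * \<eta>" using w \<open>0 < \<eta>\<close> by (simp add: dist_norm)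
  qed
  have BD: "infdist z D \<le> 4 * \<eta>" if "z \<in> B" "norm z \<le> R" for z
    using B1D that \<open>0 < \<eta>\<close> by (subst infdist_zero) (auto simp: B1_def B0_def)
  have xE: "\<epsilon> - 3 * \<eta> \<le> infdist x E"
    using infdist_triangle[of a E x] ab(6) xa by (simp add: dist_commute)
  \<comment> \<open>The shifted part of \<open>A\<close> has distance at most \<open>2 * R + 2 * \<eta>\<close> to \<open>x\<close> and at least \<open>\<mu>\<close> to the
    hyperplane.\<close>
  define K where "K = (2 * R + 2 * \<eta>) / \<mu>"
  have R0: "0 \<le> R" using abR norm_ge_zero[of a] by linarith
  have K: "0 < K" using R0 \<open>0 < \<eta>\<close> \<mu> by (simp add: K_def)
  have CK: "C \<subseteq> {z. dist z x \<le> K * (c - inner h z)}"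
    unfolding C_def
  proof (rule closure_convex_hull_minimal)
    have "dist (z + w) x \<le> K * (c - inner h (z + w))" if "z \<in> A" "norm z \<le> R" for z
    proof -
      have "z + w - x = (z - a) - s *\<^sub>R h" by (simp add: x_def)
      then have "dist (z + w) x \<le> norm (z - a) + norm (s *\<^sub>R h)"
        using norm_triangle_ineq4[of "z - a" "s *\<^sub>R h"] by (simp only: dist_norm)
      also have "\<dots> \<le> 2 * R + 2 * \<eta>"
        using norm_triangle_ineq4[of z a] that abR ns by linarith
      also have "\<dots> = K * \<mu>" using \<mu> by (simp add: K_def)
      also have "\<dots> \<le> K * (c - inner h (z + w))"
        using K c_ge[OF that] by (intro mult_left_mono) auto
      finally show ?thesis .
    qed
    then show "A1 \<subseteq> {z. dist z x \<le> K * (c - inner h z)}" by (auto simp: A1_def hx)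
    show "closed {z. dist z x \<le> K * (c - inner h z)}"
      by (intro closed_Collect_le continuous_intros)
    show "convex {z. dist z x \<le> K * (c - inner h z)}"
      using K by (intro convex_dist_le_linear) simp
  qed
  have Dh: "D \<subseteq> {z. inner h z \<ge> c + norm v}"
    unfolding D_def
  proof (rule closure_convex_hull_minimal[OF _ closed_halfspace_ge convex_halfspace_ge])
    have "c + norm v \<le> inner h z" if "z \<in> B0" for z
      using c_le[OF that] by (simp add: inner_diff hv)
    then show "B1 \<subseteq> {z. inner h z \<ge> c + norm v}" by (auto simp: B1_def inner_add hx hv)
  qed
  have "y \<longlonglongrightarrow> x" if "\<And>n. y (Suc n) = metric_proj C (metric_proj D (y n))" for y
  proof (rule alternating_projections_trapped[OF C(2,3) D(2,3) xC xvD hx h K])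
    show "dist z x \<le> K * (c - inner h z)" if "z \<in> C" for z using CK that by blast
    show "c + norm v \<le> inner h z" if "z \<in> D" for z using Dh that by blast
  qed (rule that)
  with that[of C D x] C D CA DB AC BD xE show ?thesis by blast
qed

text \<open>
  If regularity fails, the traps of quality \<open>\<eta> k\<close> and radius \<open>r + k\<close> converge to \<open>A\<close> and \<open>B\<close>, and so
  do the sets that arise when each trap is used until the orbit is close to its limit, which is far
  from \<open>E\<close>.
\<close>

lemma stable_imp_regular:
  assumes stable: "\<And>As Bs a0 a b.
      (\<And>n. n \<ge> 1 \<Longrightarrow> As n \<noteq> {} \<and> closed (As n) \<and> convex (As n)) \<Longrightarrow>
      (\<And>n. n \<ge> 1 \<Longrightarrow> Bs n \<noteq> {} \<and> closed (Bs n) \<and> convex (Bs n)) \<Longrightarrow>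
      attouch_wets As A \<Longrightarrow> attouch_wets Bs B \<Longrightarrow>
      perturbed_alternating_projections As Bs a0 a b \<Longrightarrow> (\<lambda>n. infdist (a n) E) \<longlonglongrightarrow> 0"
    and "0 < \<epsilon>"
  shows "\<exists>\<delta>>0. \<forall>x. max (infdist x A) (infdist (x + v) B) \<le> \<delta> \<longrightarrow> infdist x E \<le> \<epsilon>"
proof (rule ccontr)
  assume "\<not> ?thesis"
  then have nonreg: "\<exists>x. infdist x A \<le> \<delta> \<and> infdist (x + v) B \<le> \<delta> \<and> \<epsilon> < infdist x E"
    if "0 < \<delta>" for \<delta> using that by (auto simp: not_le)
  obtain r where r: "0 < r" and wit: "\<And>\<delta>. 0 < \<delta> \<Longrightarrow>
      \<exists>a\<in>A. \<exists>b\<in>B. norm a \<le> r \<and> norm b \<le> r \<and> norm (b - v - a) \<le> \<delta> \<and> \<epsilon> / 2 \<le> infdist a E"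
    using nonregular_witnesses[OF \<open>0 < \<epsilon>\<close> nonreg] by blast
  define \<eta> where "\<eta> k = min (1 / real (Suc k)) (\<epsilon> / 12)" for k
  have \<eta>: "0 < \<eta> k" "\<eta> k \<le> 1 / real (Suc k)" "\<eta> k \<le> \<epsilon> / 12" for k
    using \<open>0 < \<epsilon>\<close> by (auto simp: \<eta>_def)
  define near where "near k Z X \<longleftrightarrow> (X \<noteq> {} \<and> closed X \<and> convex X) \<and>
      (\<forall>z\<in>X. infdist z Z \<le> 4 * \<eta> k) \<and> (\<forall>z\<in>Z. norm z \<le> r + real k \<longrightarrow> infdist z X \<le> 4 * \<eta> k)"
    for k and Z X :: "'a set"
  have "\<forall>k. \<exists>C D x. near k A C \<and> near k B D \<and> \<epsilon> / 4 \<le> infdist x E \<and>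
      (\<forall>a. (\<forall>n. a (Suc n) = metric_proj C (metric_proj D (a n))) \<longrightarrow> a \<longlonglongrightarrow> x)"
  proof
    fix k
    have "0 < \<epsilon> / 2" "r \<le> r + real k" using \<open>0 < \<epsilon>\<close> by auto
    then show "\<exists>C D x. near k A C \<and> near k B D \<and> \<epsilon> / 4 \<le> infdist x E \<and>
      (\<forall>a. (\<forall>n. a (Suc n) = metric_proj C (metric_proj D (a n))) \<longrightarrow> a \<longlonglongrightarrow> x)"
    proof (rule trap_exists[OF _ _ \<eta>(1)[of k] wit])
      fix C D x
      assume C: "C \<noteq> {}" "closed C" "convex C" and D: "D \<noteq> {}" "closed D" "convex D"
        and nC: "\<And>z. z \<in> C \<Longrightarrow> infdist z A \<le> 4 * \<eta> k"
          "\<And>z. z \<in> A \<Longrightarrow> norm z \<le> r + real k \<Longrightarrow> infdist z C \<le> 4 * \<eta> k"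
        and nD: "\<And>z. z \<in> D \<Longrightarrow> infdist z B \<le> 4 * \<eta> k"
          "\<And>z. z \<in> B \<Longrightarrow> norm z \<le> r + real k \<Longrightarrow> infdist z D \<le> 4 * \<eta> k"
        and x: "\<epsilon> / 2 - 3 * \<eta> k \<le> infdist x E"
        and lim: "\<And>a. (\<And>n. a (Suc n) = metric_proj C (metric_proj D (a n))) \<Longrightarrow> a \<longlonglongrightarrow> x"
      have "near k A C" unfolding near_def using C nC by simp
      moreover have "near k B D" unfolding near_def using D nD by simp
      moreover have "\<epsilon> / 4 \<le> infdist x E" using x \<eta>(3)[of k] by linarith
      moreover have "\<forall>a. (\<forall>n. a (Suc n) = metric_proj C (metric_proj D (a n))) \<longrightarrow> a \<longlonglongrightarrow> x"
        by (intro allI impI lim) (erule spec)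
      ultimately show ?thesis by (intro exI conjI)
    qed
  qed
  then obtain C where "\<forall>k. \<exists>D x. near k A (C k) \<and> near k B D \<and> \<epsilon> / 4 \<le> infdist x E \<and>
      (\<forall>a. (\<forall>n. a (Suc n) = metric_proj (C k) (metric_proj D (a n))) \<longrightarrow> a \<longlonglongrightarrow> x)"
    by (rule choice[THEN exE])
  then obtain D where "\<forall>k. \<exists>x. near k A (C k) \<and> near k B (D k) \<and> \<epsilon> / 4 \<le> infdist x E \<and>
      (\<forall>a. (\<forall>n. a (Suc n) = metric_proj (C k) (metric_proj (D k) (a n))) \<longrightarrow> a \<longlonglongrightarrow> x)"
    by (rule choice[THEN exE])
  then obtain x where CDx: "\<forall>k. near k A (C k) \<and> near k B (D k) \<and> \<epsilon> / 4 \<le> infdist (x k) E \<and>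
      (\<forall>a. (\<forall>n. a (Suc n) = metric_proj (C k) (metric_proj (D k) (a n))) \<longrightarrow> a \<longlonglongrightarrow> x k)"
    by (rule choice[THEN exE])
  have conv: "a \<longlonglongrightarrow> x k" if "\<And>n. a (Suc n) = metric_proj (C k) (metric_proj (D k) (a n))" for k a
  proof -
    have "\<forall>a. (\<forall>n. a (Suc n) = metric_proj (C k) (metric_proj (D k) (a n))) \<longrightarrow> a \<longlonglongrightarrow> x k"
      using CDx by blast
    then show ?thesis using that by (elim allE[of _ a]) simp
  qed
  have "0 < \<epsilon> / 8" using \<open>0 < \<epsilon>\<close> by simp
  obtain phase a where a0: "a 0 = 0"
    and aS: "\<And>n. a (Suc n) = metric_proj (C (phase n)) (metric_proj (D (phase n)) (a n))"
    and phase: "filterlim phase at_top sequentially"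
    and close: "\<And>N. \<exists>n\<ge>N. dist (a (Suc n)) (x (phase n)) < \<epsilon> / 8"
    using concatenated_iterations[where T = "\<lambda>k y. metric_proj (C k) (metric_proj (D k) y)" and x = x
        and e = "\<epsilon> / 8" and ?a0.0 = 0, OF conv \<open>0 < \<epsilon> / 8\<close>] by metis
  \<comment> \<open>The step from \<open>a (n - 1)\<close> to \<open>a n\<close> uses the sets with index \<open>n\<close>, hence the phase of \<open>n - 1\<close>.\<close>
  have AW: "attouch_wets (\<lambda>n. X (phase (n - 1))) Z" if near: "\<And>k. near k Z (X k)" for X Z
    unfolding attouch_wets_iff
  proof (intro allI impI)
    fix \<rho> e :: real assume "0 < \<rho>" "0 < e"
    have "\<forall>\<^sub>F k in sequentially. \<rho> < real k"
      using filterlim_real_sequentially by (simp add: filterlim_at_top_dense)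
    moreover have "\<forall>\<^sub>F k in sequentially. 1 / real (Suc k) < e / 4"
      using order_tendstoD(2)[OF LIMSEQ_Suc[OF lim_1_over_n], of "e / 4"] \<open>0 < e\<close> by simp
    ultimately have "\<forall>\<^sub>F k in sequentially. (\<forall>c\<in>X k. norm c \<le> \<rho> \<longrightarrow> infdist c Z \<le> e)
        \<and> (\<forall>c\<in>Z. norm c \<le> \<rho> \<longrightarrow> infdist c (X k) \<le> e)"
    proof eventually_elim
      case (elim k)
      have "4 * \<eta> k \<le> e" using \<eta>(2)[of k] elim by linarith
      moreover have "\<rho> \<le> r + real k" using elim r by linarith
      ultimately show ?case using near[of k] unfolding near_def by (meson order_trans)
    qed
    from eventually_compose_filterlim[OF this phase]
    have "\<forall>\<^sub>F n in sequentially. (\<forall>c\<in>X (phase (Suc n - 1)). norm c \<le> \<rho> \<longrightarrow> infdist c Z \<le> e)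
        \<and> (\<forall>c\<in>Z. norm c \<le> \<rho> \<longrightarrow> infdist c (X (phase (Suc n - 1))) \<le> e)" by simp
    then show "\<forall>\<^sub>F n in sequentially. (\<forall>c\<in>X (phase (n - 1)). norm c \<le> \<rho> \<longrightarrow> infdist c Z \<le> e)
        \<and> (\<forall>c\<in>Z. norm c \<le> \<rho> \<longrightarrow> infdist c (X (phase (n - 1))) \<le> e)"
      by (rule eventually_sequentially_Suc[THEN iffD1])
  qed
  have "(\<lambda>n. infdist (a n) E) \<longlonglongrightarrow> 0"
  proof (rule stable)
    show "attouch_wets (\<lambda>n. C (phase (n - 1))) A" "attouch_wets (\<lambda>n. D (phase (n - 1))) B"
      by (rule AW, use CDx in blast)+
    show "C (phase (n - 1)) \<noteq> {} \<and> closed (C (phase (n - 1))) \<and> convex (C (phase (n - 1)))"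
      "D (phase (n - 1)) \<noteq> {} \<and> closed (D (phase (n - 1))) \<and> convex (D (phase (n - 1)))" for n
      using CDx unfolding near_def by blast+
    show "perturbed_alternating_projections (\<lambda>n. C (phase (n - 1))) (\<lambda>n. D (phase (n - 1))) 0 a
        (\<lambda>n. metric_proj (D (phase (n - 1))) (a (n - 1)))"
      unfolding perturbed_alternating_projections_def
    proof (intro conjI allI impI)
      show "a n = metric_proj (C (phase (n - 1))) (metric_proj (D (phase (n - 1))) (a (n - 1)))"
        if "1 \<le> n" for n using aS[of "n - 1"] that by simp
    qed (simp_all add: a0)
  qed
  then have "(\<lambda>n. infdist (a (Suc n)) E) \<longlonglongrightarrow> 0" by (rule LIMSEQ_Suc)
  then have "\<forall>\<^sub>F n in sequentially. infdist (a (Suc n)) E < \<epsilon> / 8"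
    using \<open>0 < \<epsilon> / 8\<close> by (rule order_tendstoD(2))
  then obtain N where N: "\<And>n. n \<ge> N \<Longrightarrow> infdist (a (Suc n)) E < \<epsilon> / 8"
    by (auto simp: eventually_sequentially)
  obtain n where n: "n \<ge> N" "dist (a (Suc n)) (x (phase n)) < \<epsilon> / 8" using close by blast
  have "\<epsilon> / 4 \<le> infdist (x (phase n)) E" using CDx by blast
  then show False
    using infdist_triangle[of "x (phase n)" E "a (Suc n)"] N[OF n(1)] n(2) by (simp add: dist_commute)
qed

end

theorem corollary1p3:
  fixes A B :: "'a::{real_inner, banach} set"
  assumes "A \<noteq> {}" "closed A" "convex A"
    and "B \<noteq> {}" "closed B" "convex B"
    and "best_approx_left A B \<noteq> {}" "bounded (best_approx_left A B)"
    and "best_approx_right A B \<noteq> {}" "bounded (best_approx_right A B)"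
  shows "regular_pair A B \<longleftrightarrow> d_stable A B"
proof -
  interpret convex_pair A B "best_approx_left A B" "displacement A B"
    using assms displacement_inner_ge[OF assms(1-6)] best_approx_left_eq[OF assms(1-6)]
    by unfold_locales auto
  have reg: "regular_pair A B \<longleftrightarrow> (\<forall>\<epsilon>>0. \<exists>\<delta>>0. \<forall>x. max (infdist x A) (infdist (x + displacement A B) B) \<le> \<delta>
      \<longrightarrow> infdist x (best_approx_left A B) \<le> \<epsilon>)"
    by (simp only: regular_pair_def infdist_image_diff)
  show ?thesis
  proof
    assume R: "regular_pair A B"
    show "d_stable A B"
      unfolding d_stable_def
    proof (intro allI impI, elim conjE)
      fix As Bs a0 a b
      assume As: "\<forall>n\<ge>1. As n \<noteq> {} \<and> closed (As n) \<and> convex (As n)"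
        and Bs: "\<forall>n\<ge>1. Bs n \<noteq> {} \<and> closed (Bs n) \<and> convex (Bs n)"
        and AW: "attouch_wets As A" "attouch_wets Bs B"
        and ap: "perturbed_alternating_projections As Bs a0 a b"
      show "(\<lambda>n. infdist (a n) (best_approx_left A B)) \<longlonglongrightarrow> 0 \<and>
          (\<lambda>n. infdist (b n) (best_approx_right A B)) \<longlonglongrightarrow> 0"
        unfolding best_approx_right_eq[OF assms(1-6)]
        using regular_imp_stable[OF R[unfolded reg, rule_format] As[rule_format] Bs[rule_format] AW ap]
        by blast
    qed
  next
    assume S: "d_stable A B"
    show "regular_pair A B"
      unfolding reg
    proof (intro allI impI)
      show "\<exists>\<delta>>0. \<forall>x. max (infdist x A) (infdist (x + displacement A B) B) \<le> \<delta>
          \<longrightarrow> infdist x (best_approx_left A B) \<le> \<epsilon>" if "0 < \<epsilon>" for \<epsilon>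
        using that by (rule stable_imp_regular[rotated]) (use S in \<open>unfold d_stable_def, blast\<close>)
    qed
  qed
qed

end
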